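(* (i) Let $p$ be a prime with $p\equiv 3\pmod 4$, and let $r$ be an integer with $1\leq r<4p$, $\gcd(r,p)=1$, and $rp\equiv 1\pmod 4$. Then for all integers $\alpha\geq 0$ and $n\geq 0$, $$ped_{-2}\left(p^{2\alpha+2}n+\frac{r\,p^{2\alpha+1}-1}{4}\right)\equiv 0\pmod 8.$$ (ii) Let $p$ be a prime with $p\equiv 1\pmod 4$, and let $r$ be an integer with $1\leq r<4p$, $\gcd(r,p)=1$, and $rp\equiv 1\pmod 4$. Then for all integers $\alpha\geq 0$ and $n\geq 0$, $$ped_{-2}\left(p^{8\alpha+8}n+\frac{r\,p^{8\alpha+7}-1}{4}\right)\equiv 0\pmod 8.$$
   Context: For an integer $n\ge 0$, $ped_{-2}(n)$ denotes the number of bipartitions of $n$ with even parts distinct, i.e. the number of ordered pairs of partitions $(\lambda,\mu)$ with total size $|\lambda|+|\mu|=n$ such that in each of $\lambda$ and $\mu$ the even parts are distinct (odd parts are unrestricted). Its generating function is $$\sum_{n=0}^{\infty}ped_{-2}(n)q^n=\prod_{m=1}^{\infty}\frac{(1-q^{4m})^2}{(1-q^m)^2}.$$ *)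

theory Defs
  imports "HOL-Library.Multiset" "HOL-Number_Theory.Number_Theory"
begin

text \<open>A partition is a finite multiset of positive integers.\<close>

definition partition_even_parts_distinct :: "nat multiset \<Rightarrow> bool" where
  "partition_even_parts_distinct P \<longleftrightarrow>
     0 \<notin># P \<and> (\<forall>m. even m \<longrightarrow> count P m \<le> 1)"

definition ped_bipartitions :: "nat \<Rightarrow> (nat multiset \<times> nat multiset) set" where
  "ped_bipartitions n =
     {(P, Q). partition_even_parts_distinct P \<and> partition_even_parts_distinct Q \<and>
              sum_mset P + sum_mset Q = n}"

text \<open>Since \<open>card\<close> is 0 on infinite sets, finiteness is what makes
  \<open>ped_minus2\<close> below an honest count.\<close>

lemma finite_ped_bipartitions: "finite (ped_bipartitions n)"
proof -
  let ?M = "{P :: nat multiset. set_mset P \<subseteq> {..n} \<and> size P \<le> n}"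
  have "?M \<subseteq> mset ` {xs. set xs \<subseteq> {..n} \<and> length xs \<le> n}"
  proof
    fix P assume P: "P \<in> ?M"
    obtain xs where "mset xs = P" using ex_mset by blast
    with P show "P \<in> mset ` {xs. set xs \<subseteq> {..n} \<and> length xs \<le> n}"
      by (force simp flip: set_mset_mset size_mset)
  qed
  then have fin: "finite ?M"
    by (rule finite_subset) (simp add: finite_lists_length_le)
  have size_le: "size P \<le> sum_mset P" if "0 \<notin># P" for P :: "nat multiset"
    using that by (induction P) auto
  have part: "P \<in> ?M" if "0 \<notin># P" "sum_mset P \<le> n" for P
  proof -
    have "m \<le> n" if "m \<in># P" for m
      using that \<open>sum_mset P \<le> n\<close> by (auto dest!: multi_member_split)
    with size_le[OF \<open>0 \<notin># P\<close>] \<open>sum_mset P \<le> n\<close> show ?thesis by auto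
  qed
  have "ped_bipartitions n \<subseteq> ?M \<times> ?M"
  proof
    fix z assume "z \<in> ped_bipartitions n"
    then obtain P Q where "z = (P, Q)" "0 \<notin># P" "0 \<notin># Q" "sum_mset P + sum_mset Q = n"
      unfolding ped_bipartitions_def partition_even_parts_distinct_def by blast
    with part[of P] part[of Q] show "z \<in> ?M \<times> ?M" by simp
  qed
  with fin show ?thesis by (meson finite_SigmaI finite_subset)
qed

definition ped_minus2 :: "nat \<Rightarrow> nat" where
  "ped_minus2 n = card (ped_bipartitions n)"

end

theory Submission
  imports Defs "HOL-Computational_Algebra.Formal_Power_Series"
begin

unbundle fps_syntax

text \<open>
  Let \<open>\<phi> = \<Sum>k\<in>\<int>. (-1)^k q^(k^2) = 1 + 2 S\<close> and \<open>\<psi> = \<Sum>j\<ge>0. q^(j (j + 1))\<close>.  Gauss's product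
  formulas for these theta series turn the generating function of \<open>ped_minus2\<close> into \<open>\<psi> / \<phi>\<close>.
  Since \<open>\<phi>^4 \<equiv> 1\<close> modulo 8, this is congruent to \<open>\<psi> \<phi>^3 \<equiv> \<psi> (1 + 6 S + 4 S(q^2))\<close>, so that
  \<open>ped_minus2 n\<close> is controlled modulo 8 by whether \<open>4 n + 1\<close> is a square and by the numbers of
  representations of \<open>4 n + 1\<close> by the forms \<open>x^2 + y^2\<close> and \<open>x^2 + 2 y^2\<close>.

  Write \<open>4 n + 1 = p^k m\<close> with \<open>k\<close> odd and \<open>m\<close> prime to \<open>p\<close>.  If \<open>p = a^2 + d b^2\<close>, multiplication by
  \<open>a \<plusminus> b \<surd>(-d)\<close> shows \<open>r(p^k m) = (k + 1) r(m)\<close> for the number \<open>r\<close> of representations by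
  \<open>x^2 + d y^2\<close>; otherwise Thue's argument shows that \<open>p^k m\<close> has no representation at all.
\<close>

section \<open>Finite forms of Gauss's identities\<close>

text \<open>Shanks's finite forms of Gauss's identities; both follow by telescoping in the step from
  \<open>n\<close> to \<open>n + 1\<close>. Every term on the right with \<open>s \<ge> 1\<close> vanishes in the limit
  \<open>n \<rightarrow> \<infinity>\<close>.\<close>

lemma gauss_square_finite:
  fixes q :: "'a :: comm_ring_1"
  shows "(\<Prod>i=1..n. 1 + q ^ i) * (1 + 2 * (\<Sum>s=1..n. (-1) ^ s * q ^ (s * s))) =
    (\<Prod>i=1..n. 1 - q ^ i) +
    2 * (\<Sum>s=1..n. (-1) ^ s * q ^ (s * (n + 1)) *
            ((\<Prod>i=s+1..n. 1 - q ^ i) * (\<Prod>i=1..<s. 1 + q ^ i)))"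
proof (induction n)
  case 0
  show ?case by simp
next
  case (Suc n)
  define N where "N = Suc n"
  define R where "R s m = (\<Prod>i=s+1..m. 1 - q ^ i) * (\<Prod>i=1..<s. 1 + q ^ i)" for s m :: nat
  define W where "W s = (\<Prod>i=s+1..n. 1 - q ^ i) * (\<Prod>i=1..s. 1 + q ^ i)" for s :: nat
  \<comment> \<open>\<open>h\<close> is the telescoping term: passing from \<open>n\<close> to
    \<open>N\<close> multiplies the \<open>s\<close>-th summand of the error sum by
    \<open>1 + q ^ N\<close>, up to the difference \<open>h (s - 1) - h s\<close>.\<close>
  define h where "h s = (-1) ^ s * q ^ ((s + 1) * N) * W s" for s :: nat
  define D where "D = (\<Prod>i=1..n. 1 + q ^ i)"
  define P where "P = (\<Prod>i=1..n. 1 - q ^ i)"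
  define T where "T = (\<Sum>s=1..n. (-1) ^ s * q ^ (s * s))"
  define U where "U = (\<Sum>s=1..n. (-1) ^ s * q ^ (s * N) * R s n)"
  have IH: "D * (1 + 2 * T) = P + 2 * U"
    using Suc.IH by (simp add: D_def T_def P_def U_def R_def N_def)
  have step: "(-1) ^ s * q ^ (s * (N + 1)) * R s N =
      (1 + q ^ N) * ((-1) ^ s * q ^ (s * N) * R s n) + (h (s - 1) - h s)"
    if s: "s \<in> {1..n}" for s
  proof -
    have RN: "R s N = R s n * (1 - q ^ N)"
      using s by (simp add: R_def N_def algebra_simps)
    have "{s..n} = insert s {s+1..n}" using s by auto
    then have W1: "W (s - 1) = R s n * (1 - q ^ s)"
      using s by (simp add: W_def R_def algebra_simps atLeastLessThanSuc_atLeastAtMost[symmetric])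
    have "{1..s} = insert s {1..<s}" using s by auto
    then have W2: "W s = R s n * (1 + q ^ s)"
      by (simp add: W_def R_def algebra_simps)
    obtain t where t: "s = Suc t" using s by (cases s) auto
    show ?thesis
      unfolding h_def W1 W2 RN using t
      by (simp add: algebra_simps power_add)
  qed
  have "(\<Sum>s=1..n. (-1) ^ s * q ^ (s * (N + 1)) * R s N) =
     (1 + q ^ N) * U + (\<Sum>s=1..n. h (s - 1) - h s)"
    unfolding U_def sum_distrib_left sum.distrib[symmetric]
    by (intro sum.cong refl step)
  also have "(\<Sum>s=1..n. h (s - 1) - h s) = h 0 - h n"
    by (induction n) (auto)
  finally have S: "(\<Sum>s=1..N. (-1) ^ s * q ^ (s * (N + 1)) * R s N) =
     (1 + q ^ N) * U + h 0 - h n + (-1) ^ N * q ^ (N * (N + 1)) * R N N"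
    by (simp add: N_def)
  \<comment> \<open>The left boundary term turns \<open>(1 - q ^ N) * P\<close> into
    \<open>(1 + q ^ N) * P\<close>; the right one, together with the new summand
    \<open>s = N\<close>, supplies the new square term of the theta sum.\<close>
  have h0: "h 0 = q ^ N * P" by (simp add: h_def W_def P_def)
  have hn: "h n = - ((-1) ^ N * q ^ (N * N) * D)" by (simp add: h_def W_def D_def N_def)
  have RNN: "R N N = D"
    by (simp add: R_def D_def N_def atLeastLessThanSuc_atLeastAtMost)
  have "(1 + q ^ N) * D * (1 + 2 * (T + (-1) ^ N * q ^ (N * N))) =
    (1 - q ^ N) * P + 2 * ((1 + q ^ N) * U + h 0 - h n + (-1) ^ N * q ^ (N * (N + 1)) * R N N)"
  proof -
    have "(1 + q ^ N) * D * (1 + 2 * (T + (-1) ^ N * q ^ (N * N))) =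
      (1 + q ^ N) * (D * (1 + 2 * T)) + (1 + q ^ N) * D * 2 * (-1) ^ N * q ^ (N * N)"
      by (simp add: algebra_simps)
    then show ?thesis
      unfolding IH h0 hn RNN by (simp add: algebra_simps power_add)
  qed
  then show ?case
    using S unfolding N_def
    by (simp add: D_def T_def P_def R_def mult.commute)
qed

lemma gauss_triangular_finite:
  fixes x :: "'a :: comm_ring_1"
  shows "(\<Prod>i<n. 1 - x ^ (2 * i + 1)) * (\<Sum>s<2 * n. x ^ (s * (s + 1) div 2)) =
    (\<Sum>s<n. x ^ (s * (2 * n + 1)) *
      ((\<Prod>i=s..<n. 1 - x ^ (2 * i + 2)) * (\<Prod>i<s. 1 - x ^ (2 * i + 1))))"
proof (induction n)
  case 0
  show ?case by simp
next
  case (Suc n)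
  define R where "R s m = (\<Prod>i=s..<m. 1 - x ^ (2 * i + 2)) * (\<Prod>i<s. 1 - x ^ (2 * i + 1))"
    for s m :: nat
  \<comment> \<open>The factor \<open>1 - x ^ (2 * s)\<close> makes \<open>g 0\<close> vanish, and
    in \<open>g (Suc s)\<close> it restores the factor that \<open>R (Suc s) n\<close> lacks
    compared with \<open>R s n\<close>.\<close>
  define g where "g s = x ^ (s * (2 * n + 1)) * ((1 - x ^ (2 * s)) * R s n)" for s :: nat
  define D where "D = (\<Prod>i<n. 1 - x ^ (2 * i + 1))"
  define T where "T = (\<Sum>s<2 * n. x ^ (s * (s + 1) div 2))"
  define U where "U = (\<Sum>s<n. x ^ (s * (2 * n + 1)) * R s n)"
  have IH: "D * T = U"
    using Suc.IH by (simp add: D_def T_def U_def R_def)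
  have step: "x ^ (s * (2 * Suc n + 1)) * R s (Suc n) =
      (1 - x ^ (2 * n + 1)) * (x ^ (s * (2 * n + 1)) * R s n) + (g (Suc s) - g s)"
    if s: "s \<in> {..<n}" for s
  proof -
    have RN: "R s (Suc n) = R s n * (1 - x ^ (2 * n + 2))"
      using s by (simp add: R_def algebra_simps)
    have "{s..<n} = insert s {Suc s..<n}" using s by auto
    then have "(1 - x ^ (2 * Suc s)) * R (Suc s) n = (1 - x ^ (2 * s + 1)) * R s n"
      by (simp add: R_def algebra_simps)
    then have g: "g (Suc s) = x ^ (Suc s * (2 * n + 1)) * ((1 - x ^ (2 * s + 1)) * R s n)"
      by (simp only: g_def)
    have ex: "s * (2 * Suc n + 1) = s * (2 * n + 1) + 2 * s"
      "Suc s * (2 * n + 1) = s * (2 * n + 1) + (2 * n + 1)" "2 * n + 2 = 2 * n + 1 + 1"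
      by simp_all
    show ?thesis
      unfolding g unfolding g_def RN ex power_add power_one_right by (simp only: algebra_simps mult_1_left mult_1_right)
  qed
  have "(\<Sum>s<n. x ^ (s * (2 * Suc n + 1)) * R s (Suc n)) =
     (1 - x ^ (2 * n + 1)) * U + (\<Sum>s<n. g (Suc s) - g s)"
    unfolding U_def sum_distrib_left sum.distrib[symmetric]
    by (intro sum.cong refl step)
  also have "(\<Sum>s<n. g (Suc s) - g s) = g n - g 0"
    by (rule sum_lessThan_telescope)
  also have "g 0 = 0" by (simp add: g_def)
  finally have S: "(\<Sum>s<Suc n. x ^ (s * (2 * Suc n + 1)) * R s (Suc n)) =
     (1 - x ^ (2 * n + 1)) * U + g n + x ^ (n * (2 * Suc n + 1)) * R n (Suc n)"
    by simp
  have gn: "g n = x ^ (n * (2 * n + 1)) * (1 - x ^ (2 * n)) * D"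
    by (simp add: g_def R_def D_def)
  have Rn: "R n (Suc n) = (1 - x ^ (2 * n + 2)) * D"
    by (simp add: R_def D_def)
  \<comment> \<open>Each induction step adds two triangular exponents, those of
    \<open>s = 2 * n\<close> and \<open>s = 2 * n + 1\<close>.\<close>
  have tri: "2 * n * (2 * n + 1) div 2 = n * (2 * n + 1)"
    "Suc (2 * n) * (Suc (2 * n) + 1) div 2 = n * (2 * n + 1) + (2 * n + 1)"
    by (simp_all add: algebra_simps)
  have S2: "2 * Suc n = Suc (Suc (2 * n))" by simp
  have T': "(\<Sum>s<2 * Suc n. x ^ (s * (s + 1) div 2)) =
      T + x ^ (n * (2 * n + 1)) + x ^ (n * (2 * n + 1)) * x ^ (2 * n + 1)"
    unfolding T_def S2 sum.lessThan_Suc tri power_add[of x "n * (2 * n + 1)"] ..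
  have "(1 - x ^ (2 * n + 1)) * D * (T + x ^ (n * (2 * n + 1)) + x ^ (n * (2 * n + 1)) * x ^ (2 * n + 1)) =
    (1 - x ^ (2 * n + 1)) * (D * T) + (1 - x ^ (2 * n + 1)) * D * (x ^ (n * (2 * n + 1)) + x ^ (n * (2 * n + 1)) * x ^ (2 * n + 1))"
    by (simp add: algebra_simps)
  also have "\<dots> = (1 - x ^ (2 * n + 1)) * U + g n + x ^ (n * (2 * Suc n + 1)) * R n (Suc n)"
  proof -
    have ex: "n * (2 * Suc n + 1) = n * (2 * n + 1) + 2 * n" "2 * n + 2 = 2 * n + 1 + 1"
      by simp_all
    show ?thesis
      unfolding IH gn Rn ex power_add[of x "n * (2 * n + 1)"] power_add[of x "2 * n"]
        power_add[of x "2 * n + 1"] power_one_right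
      by (simp only: algebra_simps mult_1_left mult_1_right)
  qed
  finally show ?case
    unfolding T' S[symmetric] by (simp add: D_def R_def mult.commute)
qed

section \<open>Power series modulo a power of the variable\<close>

text \<open>Divisibility of a difference by \<open>fps_X ^ k\<close> means agreement of the first
  \<open>k\<close> coefficients. Truncation thereby becomes ring arithmetic, and no infinite product
  or limit has to be formed.\<close>

lemma fps_X_power_dvd_iff:
  fixes f :: "'a :: comm_ring_1 fps"
  shows "fps_X ^ k dvd f \<longleftrightarrow> (\<forall>i<k. f $ i = 0)"
proof
  assume "fps_X ^ k dvd f"
  then show "\<forall>i<k. f $ i = 0"
    by (auto simp: dvd_def fps_X_power_mult_nth)
next
  assume "\<forall>i<k. f $ i = 0"
  then have "fps_cutoff k f = 0"
    by (intro fps_ext) simp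
  then show "fps_X ^ k dvd f"
    using fps_shift_cutoff'[of k f] by (metis add.right_neutral dvd_triv_left)
qed

text \<open>A series with constant term 1 is a unit.\<close>

lemma fps_X_power_dvd_cancel:
  fixes f u :: "'a :: comm_ring_1 fps"
  assumes "u $ 0 = 1" "fps_X ^ k dvd u * f"
  shows "fps_X ^ k dvd f"
proof -
  have "u * fps_right_inverse u 1 = 1"
    using assms(1) by (intro fps_right_inverse) simp
  then have "f = u * f * fps_right_inverse u 1"
    by (simp add: algebra_simps)
  with assms(2) show ?thesis by (metis dvd_mult2)
qed

text \<open>The reflection of \<open>i\<close> to \<open>n - i\<close> pairs equal terms of the
  Cauchy product, so modulo 2 only the middle term survives, and an integer is congruent to its
  square.\<close>

lemma square_coeff_mod2:
  fixes f :: "int fps"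
  shows "[(f * f) $ n = (if even n then f $ (n div 2) else 0)] (mod 2)"
proof -
  define g where "g i = f $ i * f $ (n - i)" for i
  have n: "(f * f) $ n = (\<Sum>i=0..n. g i)"
    by (simp add: fps_mult_nth g_def)
  define A where "A = {i. 2 * i < n}"
  define B where "B = {i. n < 2 * i \<and> i \<le> n}"
  define C where "C = {i. 2 * i = n}"
  have fin: "finite A" "finite B" "finite C"
    by (rule finite_subset[of _ "{..n}"]; force simp: A_def B_def C_def)+
  have U: "{0..n} = A \<union> B \<union> C" by (auto simp: A_def B_def C_def)
  have sB: "sum g B = sum g A"
    by (rule sum.reindex_bij_witness[of _ "\<lambda>i. n - i" "\<lambda>i. n - i"])
      (auto simp: A_def B_def g_def)
  have "(f * f) $ n = sum g (A \<union> B) + sum g C"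
    unfolding n U using fin by (intro sum.union_disjoint) (auto simp: A_def B_def C_def)
  also have "sum g (A \<union> B) = 2 * sum g A"
    using fin sB by (subst sum.union_disjoint) (auto simp: A_def B_def)
  finally have 1: "(f * f) $ n = 2 * sum g A + sum g C" .
  have "C = (if even n then {n div 2} else {})" by (auto simp: C_def)
  then have "sum g C = (if even n then f $ (n div 2) * f $ (n div 2) else 0)"
    by (auto simp: g_def)
  with 1 show ?thesis by (auto simp: cong_iff_dvd_diff)
qed

section \<open>Theta series\<close>

text \<open>This is \<open>S\<close> of the outline. The sign can be read off from the exponent
  because \<open>k * k\<close> and \<open>k\<close> have the same parity.\<close>

definition alternating_square_fps :: "int fps" where
  "alternating_square_fps = Abs_fps (\<lambda>n. if \<exists>k>0. n = k * k then (-1) ^ n else 0)"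

definition pronic_fps :: "int fps" where
  "pronic_fps = Abs_fps (\<lambda>n. if \<exists>j. n = j * (j + 1) then 1 else 0)"

lemma alternating_square_fps_partial_sum:
  "fps_X ^ ((m + 1) * (m + 1)) dvd alternating_square_fps - (\<Sum>s=1..m. (-1) ^ s * fps_X ^ (s * s))"
  unfolding fps_X_power_dvd_iff
proof (intro allI impI)
  fix i assume i: "i < (m + 1) * (m + 1)"
  have c: "((-1) ^ s * fps_X ^ (s * s)) $ i = (if i = s * s then (-1) ^ i else (0::int))" for s
  proof -
    have "(-1 :: int fps) ^ s = fps_const ((-1) ^ s)"
      by (metis fps_const_1_eq_1 fps_const_neg fps_const_power)
    moreover have "(-1 :: int) ^ s = (-1) ^ (s * s)"
      by (cases "even s") auto
    ultimately show ?thesis by (auto simp: fps_X_power_nth)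
  qed
  have "(\<Sum>s=1..m. (-1) ^ s * fps_X ^ (s * s)) $ i = (\<Sum>s=1..m. if i = s * s then (-1) ^ i else (0::int))"
    unfolding fps_sum_nth c ..
  also have "\<dots> = alternating_square_fps $ i"
  proof (cases "\<exists>k>0. i = k * k")
    case True
    then obtain k where k: "i = k * k" "k > 0" by blast
    have "k < m + 1"
      using i unfolding k by (meson linorder_not_less mult_le_mono)
    have "i = s * s \<longleftrightarrow> s = k" for s
      unfolding k by (metis power2_eq_square power2_eq_iff_nonneg zero_le)
    then show ?thesis
      using True k \<open>k < m + 1\<close> by (auto simp: alternating_square_fps_def sum.delta)
  next
    case False
    then have "(if i = s * s then (-1) ^ i else (0::int)) = 0" if "s \<in> {1..m}" for s
    proof -
      from that have "s > 0" by simp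
      with False have "i \<noteq> s * s" by blast
      then show ?thesis by simp
    qed
    then have "(\<Sum>s=1..m. if i = s * s then (-1) ^ i else (0::int)) = 0"
      by (rule sum.neutral[OF ballI])
    then show ?thesis using False unfolding alternating_square_fps_def by auto
  qed
  finally show "(alternating_square_fps - (\<Sum>s=1..m. (-1) ^ s * fps_X ^ (s * s))) $ i = 0"
    by simp
qed

lemma pronic_eq_iff:
  fixes j k :: nat
  shows "j * (j + 1) = k * (k + 1) \<longleftrightarrow> j = k"
proof (cases j k rule: linorder_cases)
  case less
  then have "j * (j + 1) < k * (k + 1)" by (intro mult_strict_mono) auto
  with less show ?thesis by simp
next
  case greater
  then have "k * (k + 1) < j * (j + 1)" by (intro mult_strict_mono) auto
  with greater show ?thesis by simp
qed simp

lemma pronic_fps_partial_sum: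
  "fps_X ^ (m * (m + 1)) dvd pronic_fps - (\<Sum>s<m. fps_X ^ (s * (s + 1)))"
  unfolding fps_X_power_dvd_iff
proof (intro allI impI)
  fix i assume i: "i < m * (m + 1)"
  have "(\<Sum>s<m. fps_X ^ (s * (s + 1))) $ i = (\<Sum>s<m. if i = s * (s + 1) then 1 else (0::int))"
    by (simp only: fps_sum_nth fps_X_power_nth)
  also have "\<dots> = pronic_fps $ i"
  proof (cases "\<exists>k. i = k * (k + 1)")
    case True
    then obtain k where k: "i = k * (k + 1)" by auto
    have "k < m"
      using i unfolding k by (meson linorder_not_less mult_le_mono add_le_mono1)
    have inj: "i = s * (s + 1) \<longleftrightarrow> s = k" for s
      unfolding k by (metis pronic_eq_iff)
    show ?thesis
      using \<open>k < m\<close> unfolding inj by (simp only: pronic_fps_def fps_nth_Abs_fps True) simp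
  next
    case False
    then show ?thesis by (simp add: pronic_fps_def)
  qed
  finally show "(pronic_fps - (\<Sum>s<m. fps_X ^ (s * (s + 1)))) $ i = 0"
    by simp
qed

section \<open>The generating function\<close>

text \<open>Bounding the parts by \<open>M\<close> allows the generating function to be built up one
  part size at a time.\<close>

definition ped_partitions_upto :: "nat \<Rightarrow> nat \<Rightarrow> nat multiset set" where
  "ped_partitions_upto M n =
     {P. partition_even_parts_distinct P \<and> set_mset P \<subseteq> {..M} \<and> sum_mset P = n}"

definition ped_fps :: "nat \<Rightarrow> int fps" where
  "ped_fps M = Abs_fps (\<lambda>n. int (card (ped_partitions_upto M n)))"

lemma finite_ped_partitions_upto: "finite (ped_partitions_upto M n)"
proof -
  have "(\<lambda>P. (P, {#})) ` ped_partitions_upto M n \<subseteq> ped_bipartitions n"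
    by (auto simp: ped_partitions_upto_def ped_bipartitions_def partition_even_parts_distinct_def)
  then show ?thesis
    using finite_ped_bipartitions by (metis finite_subset finite_imageD inj_onI prod.inject)
qed

lemma ped_partitions_upto_stable:
  assumes "n \<le> M"
  shows "ped_partitions_upto M n = {P. partition_even_parts_distinct P \<and> sum_mset P = n}"
  using assms by (auto simp: ped_partitions_upto_def dest!: multi_member_split)

text \<open>Either \<open>Suc M\<close> does not occur, or one copy of it is removed.
  \<open>M'\<close> bounds the parts of what is left and treats both parities at once: an even part
  may not occur again, an odd one may.\<close>

lemma ped_partitions_upto_Suc:
  assumes "even (Suc M) \<longrightarrow> M' = M" "odd (Suc M) \<longrightarrow> M' = Suc M"
  shows "ped_partitions_upto (Suc M) n = ped_partitions_upto M n \<union>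
    (if Suc M \<le> n then add_mset (Suc M) ` ped_partitions_upto M' (n - Suc M) else {})" (is "?L = ?R")
proof (intro equalityI subsetI)
  fix P assume P: "P \<in> ?L"
  show "P \<in> ?R"
  proof (cases "Suc M \<in># P")
    case False
    with P have "P \<in> ped_partitions_upto M n"
      by (auto simp: ped_partitions_upto_def le_Suc_eq)
    then show ?thesis by blast
  next
    case True
    then obtain Q where Q: "P = add_mset (Suc M) Q" by (metis mset_add)
    from P have n: "Suc M \<le> n" "sum_mset Q = n - Suc M" and Q0: "0 \<notin># Q"
      and sub: "set_mset Q \<subseteq> {..Suc M}"
      and c: "\<And>m. even m \<Longrightarrow> count P m \<le> 1"
      by (auto simp: ped_partitions_upto_def Q partition_even_parts_distinct_def)
    have c': "count Q m \<le> 1" if "even m" for m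
      using c[OF that] by (auto simp: Q split: if_splits)
    have "set_mset Q \<subseteq> {..M'}"
    proof (cases "even (Suc M)")
      case True
      then have "Suc M \<notin># Q" using c[OF True] by (simp add: Q not_in_iff)
      then have "x \<le> M" if "x \<in># Q" for x
        using sub that by (metis atMost_iff le_Suc_eq subsetD)
      then show ?thesis using assms(1) True by auto
    qed (use sub assms in auto)
    then have "Q \<in> ped_partitions_upto M' (n - Suc M)"
      using n Q0 c' by (auto simp: ped_partitions_upto_def partition_even_parts_distinct_def)
    with n Q show ?thesis by auto
  qed
next
  fix P assume "P \<in> ?R"
  then consider "P \<in> ped_partitions_upto M n" | Q where "Suc M \<le> n" "P = add_mset (Suc M) Q"
      "Q \<in> ped_partitions_upto M' (n - Suc M)"
    by (auto split: if_splits)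
  then show "P \<in> ?L"
  proof cases
    case 1
    then show ?thesis by (auto simp: ped_partitions_upto_def)
  next
    case 2
    have "M' \<le> Suc M" using assms by (cases "even (Suc M)") auto
    have "count Q (Suc M) = 0" if "even (Suc M)"
      using 2(3) assms(1) that by (auto simp: ped_partitions_upto_def not_in_iff[symmetric])
    then show ?thesis
      using 2 \<open>M' \<le> Suc M\<close>
      by (auto simp: ped_partitions_upto_def partition_even_parts_distinct_def)
  qed
qed

lemma ped_fps_Suc:
  assumes "even (Suc M) \<longrightarrow> M' = M" "odd (Suc M) \<longrightarrow> M' = Suc M"
  shows "ped_fps (Suc M) = ped_fps M + fps_X ^ Suc M * ped_fps M'"
proof (rule fps_ext)
  fix n
  have "card (ped_partitions_upto (Suc M) n) = card (ped_partitions_upto M n) +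
    (if Suc M \<le> n then card (ped_partitions_upto M' (n - Suc M)) else 0)"
  proof -
    have "add_mset (Suc M) Q \<notin> ped_partitions_upto M n" for Q
      by (auto simp: ped_partitions_upto_def)
    then have d: "ped_partitions_upto M n \<inter>
      (if Suc M \<le> n then add_mset (Suc M) ` ped_partitions_upto M' (n - Suc M) else {}) = {}"
      by auto
    show ?thesis
      unfolding ped_partitions_upto_Suc[OF assms]
      by (subst card_Un_disjoint[OF _ _ d])
        (auto simp: finite_ped_partitions_upto intro!: card_image inj_onI)
  qed
  then show "ped_fps (Suc M) $ n = (ped_fps M + fps_X ^ Suc M * ped_fps M') $ n"
    unfolding ped_fps_def fps_add_nth fps_X_power_mult_nth by auto
qed

lemma ped_fps_0: "ped_fps 0 = 1"
proof (rule fps_ext)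
  fix n
  have "ped_partitions_upto 0 n = (if n = 0 then {{#}} else {})"
  proof -
    have "P = {#}" if "P \<in> ped_partitions_upto 0 n" for P
      using that by (cases P) (auto simp: ped_partitions_upto_def partition_even_parts_distinct_def)
    moreover have "{#} \<in> ped_partitions_upto 0 0"
      by (simp add: ped_partitions_upto_def partition_even_parts_distinct_def)
    moreover have "n = 0" if "{#} \<in> ped_partitions_upto 0 n"
      using that by (simp add: ped_partitions_upto_def)
    ultimately show ?thesis by auto
  qed
  then show "ped_fps 0 $ n = 1 $ n" by (simp add: ped_fps_def)
qed

text \<open>An even part contributes a factor \<open>1 + fps_X ^ (2 * i + 2)\<close>, an odd part a
  geometric series; the denominators of the latter are cleared so that only finite products
  appear.\<close>

lemma ped_fps_product:
  "(\<Prod>i<N. 1 - fps_X ^ (2 * i + 1)) * ped_fps (2 * N) = (\<Prod>i<N. 1 + fps_X ^ (2 * i + 2))"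
proof (induction N)
  case 0
  show ?case by (simp add: ped_fps_0)
next
  case (Suc N)
  have 1: "(1 - fps_X ^ (2 * N + 1)) * ped_fps (2 * N + 1) = ped_fps (2 * N)"
    using ped_fps_Suc[of "2 * N" "2 * N + 1"] by (simp add: algebra_simps)
  have 2: "ped_fps (2 * Suc N) = (1 + fps_X ^ (2 * N + 2)) * ped_fps (2 * N + 1)"
    using ped_fps_Suc[of "2 * N + 1" "2 * N + 1"] by (simp add: algebra_simps)
  have "(\<Prod>i<Suc N. 1 - fps_X ^ (2 * i + 1)) * ped_fps (2 * Suc N) =
    (\<Prod>i<N. 1 - fps_X ^ (2 * i + 1)) * (1 + fps_X ^ (2 * N + 2)) *
      ((1 - fps_X ^ (2 * N + 1)) * ped_fps (2 * N + 1))"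
    unfolding 2 by (simp only: prod.lessThan_Suc ac_simps)
  also have "\<dots> = (1 + fps_X ^ (2 * N + 2)) * ((\<Prod>i<N. 1 - fps_X ^ (2 * i + 1)) * ped_fps (2 * N))"
    unfolding 1 by (simp only: ac_simps)
  finally show ?case
    unfolding Suc.IH by (simp only: prod.lessThan_Suc ac_simps)
qed

text \<open>For sizes up to \<open>M\<close> the bound on the parts is vacuous, and pairs of
  partitions are counted by a Cauchy product.\<close>

lemma ped_minus2_eq_coeff:
  assumes "n \<le> M"
  shows "int (ped_minus2 n) = (ped_fps M * ped_fps M) $ n"
proof -
  have "ped_bipartitions n =
    (\<Union>i\<in>{0..n}. ped_partitions_upto M i \<times> ped_partitions_upto M (n - i))"
    using assms by (force simp: ped_bipartitions_def ped_partitions_upto_stable)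
  then have "ped_minus2 n =
    card (\<Union>i\<in>{0..n}. ped_partitions_upto M i \<times> ped_partitions_upto M (n - i))"
    by (simp add: ped_minus2_def)
  also have "\<dots> = (\<Sum>i=0..n. card (ped_partitions_upto M i \<times> ped_partitions_upto M (n - i)))"
    by (rule card_UN_disjoint) ((simp add: finite_ped_partitions_upto; fail) |
        (auto simp: ped_partitions_upto_def; fail))+
  finally show ?thesis
    by (simp add: ped_fps_def fps_mult_nth card_cartesian_product)
qed

lemma prod_odd_even_split:
  fixes f :: "nat \<Rightarrow> 'a :: comm_monoid_mult"
  shows "(\<Prod>i=1..2 * N. f i) = (\<Prod>i<N. f (2 * i + 1)) * (\<Prod>i<N. f (2 * i + 2))"
  by (induction N) (simp_all add: ac_simps)

text \<open>Modulo \<open>fps_X ^ K\<close> the partition series is \<open>Ep / Om\<close>, the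
  first Gauss identity gives \<open>\<phi> = Om * Em / (Op * Ep)\<close>, and the second one, taken
  at \<open>fps_X ^ 2\<close>, gives \<open>pronic_fps = Em * Ep / (Om * Op)\<close>. Hence the
  squared partition series times \<open>\<phi>\<close> is \<open>pronic_fps\<close>. As
  \<open>K > n\<close>, this settles the coefficient at \<open>n\<close>.\<close>

lemma ped_fps_times_theta:
  "Abs_fps (\<lambda>n. int (ped_minus2 n)) * (1 + 2 * alternating_square_fps) = pronic_fps"
proof (rule fps_ext)
  fix n
  define N K where "N = Suc n" and "K = 2 * N + 1"
  define G where "G = Abs_fps (\<lambda>n. int (ped_minus2 n))"
  define F where "F = ped_fps (2 * N)"
  define Om where "Om = (\<Prod>i<N. 1 - fps_X ^ (2 * i + 1) :: int fps)"
  define Op where "Op = (\<Prod>i<N. 1 + fps_X ^ (2 * i + 1) :: int fps)"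
  define Em where "Em = (\<Prod>i<N. 1 - fps_X ^ (2 * i + 2) :: int fps)"
  define Ep where "Ep = (\<Prod>i<N. 1 + fps_X ^ (2 * i + 2) :: int fps)"
  define \<phi> where "\<phi> = 1 + 2 * alternating_square_fps"
  have F: "Om * F = Ep"
    unfolding Om_def F_def Ep_def by (rule ped_fps_product)
  have "fps_X ^ K dvd G - F * F"
    unfolding fps_X_power_dvd_iff
    using ped_minus2_eq_coeff[of _ "2 * N"] by (simp add: G_def F_def K_def)
  then obtain h1 where h1: "G = F * F + fps_X ^ K * h1"
    by (metis dvd_def add_diff_cancel_left' diff_add_cancel add.commute)
  have "fps_X ^ K dvd Op * Ep * \<phi> - Om * Em"
  proof -
    define T where "T = (\<Sum>s=1..2 * N. (-1) ^ s * fps_X ^ (s * s) :: int fps)"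
    define R where "R = (\<Sum>s=1..2 * N. (-1) ^ s * fps_X ^ (s * (2 * N + 1)) *
       ((\<Prod>i=s+1..2 * N. 1 - fps_X ^ i) * (\<Prod>i=1..<s. 1 + fps_X ^ i)) :: int fps)"
    have fin: "Op * Ep * (1 + 2 * T) = Om * Em + 2 * R"
      using gauss_square_finite[of "fps_X :: int fps" "2 * N"]
      unfolding prod_odd_even_split Op_def Ep_def Om_def Em_def T_def R_def by simp
    have K1: "K \<le> s * (2 * N + 1)" if "1 \<le> s" for s
      using mult_le_mono1[OF that, of "2 * N + 1"] by (simp add: K_def)
    have "fps_X ^ K dvd R"
      unfolding R_def
      by (rule dvd_sum, rule dvd_mult2, rule dvd_mult, rule le_imp_power_dvd, rule K1) simp
    moreover have "fps_X ^ K dvd alternating_square_fps - T"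
      using alternating_square_fps_partial_sum[of "2 * N"] unfolding T_def K_def
      by (rule power_le_dvd) simp
    moreover have "Op * Ep * \<phi> - Om * Em = Op * Ep * 2 * (alternating_square_fps - T) + 2 * R"
      using fin by (simp add: \<phi>_def algebra_simps)
    ultimately show ?thesis by (metis dvd_add dvd_mult)
  qed
  then obtain h2 where h2: "Op * Ep * \<phi> = Om * Em + fps_X ^ K * h2"
    by (metis dvd_def add.commute diff_add_cancel)
  have "fps_X ^ K dvd pronic_fps * (Om * Op) - Em * Ep"
  proof -
    define x where "x = (fps_X ^ 2 :: int fps)"
    define T where "T = (\<Sum>s<2 * N. fps_X ^ (s * (s + 1)) :: int fps)"
    \<comment> \<open>The summand \<open>s = 0\<close> of the finite identity is the main term
      \<open>Em * Ep\<close>; \<open>R\<close> collects the others, shifted by one, and each is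
      divisible by \<open>fps_X ^ K\<close>.\<close>
    define R where "R = (\<Sum>s<n. x ^ (Suc s * (2 * N + 1)) *
       ((\<Prod>i=Suc s..<N. 1 - x ^ (2 * i + 2)) * (\<Prod>i<Suc s. 1 - x ^ (2 * i + 1))) :: int fps)"
    have sq: "1 - x ^ k = (1 - fps_X ^ k) * (1 + fps_X ^ k)" for k
      by (simp add: x_def algebra_simps power2_eq_square flip: power_mult power_add mult_2)
    have O: "(\<Prod>i<N. 1 - x ^ (2 * i + 1)) = Om * Op"
      unfolding Om_def Op_def sq prod.distrib ..
    have E: "(\<Prod>i=0..<N. 1 - x ^ (2 * i + 2)) = Em * Ep"
      unfolding Em_def Ep_def sq prod.distrib atLeast0LessThan ..
    have tri: "x ^ (s * (s + 1) div 2) = fps_X ^ (s * (s + 1))" for s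
      unfolding x_def power_mult[symmetric] by simp
    have fin: "Om * Op * T = Em * Ep + R"
    proof -
      have "{..<N} = insert 0 (Suc ` {..<n})" by (auto simp: N_def lessThan_Suc_eq_insert_0)
      then have "(\<Sum>s<N. f s) = f 0 + (\<Sum>s<n. f (Suc s))" for f :: "nat \<Rightarrow> int fps"
        by (simp add: sum.reindex)
      then show ?thesis
        using gauss_triangular_finite[of x N] unfolding O tri T_def R_def E[symmetric] by simp
    qed
    have "fps_X ^ K dvd R"
      unfolding R_def x_def power_mult[symmetric]
      by (intro dvd_sum dvd_mult2 le_imp_power_dvd) (auto simp: K_def)
    moreover have "fps_X ^ K dvd pronic_fps - T"
      using pronic_fps_partial_sum[of "2 * N"] unfolding T_def
      by (rule power_le_dvd) (simp add: K_def N_def)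
    moreover have "pronic_fps * (Om * Op) - Em * Ep = Om * Op * (pronic_fps - T) + R"
      using fin by (simp add: algebra_simps)
    ultimately show ?thesis by (metis dvd_add dvd_mult)
  qed
  then obtain h3 where h3: "pronic_fps * (Om * Op) = Em * Ep + fps_X ^ K * h3"
    by (metis dvd_def add.commute diff_add_cancel)
  \<comment> \<open>\<open>U\<close> is a common denominator of the three quotients; its constant
    term is 1, so it can be cancelled at the end.\<close>
  define U where "U = Om * Om * (Op * Ep)"
  have "U * (G * \<phi> - pronic_fps) =
    Om * Om * fps_X ^ K * h1 * (Op * Ep * \<phi>) + (Om * F) * (Om * F) * (Op * Ep * \<phi>)
      - Om * Ep * (pronic_fps * (Om * Op))"
    unfolding h1 U_def by (simp only: algebra_simps)
  also have "\<dots> = fps_X ^ K * (Om * Om * h1 * (Op * Ep * \<phi>) + Ep * Ep * h2 - Om * Ep * h3)"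
    unfolding F h2 h3 by (simp only: algebra_simps)
  finally have "fps_X ^ K dvd U * (G * \<phi> - pronic_fps)"
    by (metis dvd_triv_left)
  moreover have "U $ 0 = 1"
  proof -
    have "(\<Prod>i<M. f i) $ 0 = 1" if "\<And>i. f i $ 0 = 1" for f :: "nat \<Rightarrow> int fps" and M
      by (induction M) (simp_all add: that)
    then show ?thesis by (simp add: U_def Om_def Op_def Ep_def fps_X_power_nth)
  qed
  ultimately have "fps_X ^ K dvd G * \<phi> - pronic_fps"
    by (rule fps_X_power_dvd_cancel[rotated])
  then have "(G * \<phi> - pronic_fps) $ n = 0"
    unfolding fps_X_power_dvd_iff by (auto simp: K_def N_def)
  then show "(Abs_fps (\<lambda>n. int (ped_minus2 n)) * (1 + 2 * alternating_square_fps)) $ n = pronic_fps $ n"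
    by (simp add: G_def \<phi>_def)
qed

text \<open>Since \<open>(2 j + 1)^2 + d (2 k)^2 = 4 (j (j + 1) + d k^2) + 1\<close>, these pairs correspond to
  representations of \<open>4 n + 1\<close> by \<open>x^2 + d y^2\<close> up to signs.\<close>

definition pronic_reps :: "nat \<Rightarrow> nat \<Rightarrow> (nat \<times> nat) set" where
  "pronic_reps d n = {(j, k). k > 0 \<and> j * (j + 1) + d * (k * k) = n}"

section \<open>Coefficients of products of theta series, and the reduction modulo 8\<close>

text \<open>Both factors have coefficients 0 and 1, and a pair \<open>(j, k)\<close> is determined
  by the exponent \<open>j * (j + 1)\<close> that it contributes.\<close>

lemma pronic_times_indicator_coeff:
  assumes "d > 0"
  shows "(pronic_fps * Abs_fps (\<lambda>m. if \<exists>k>0. m = d * (k * k) then 1 else 0)) $ n =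
    int (card (pronic_reps d n))"
proof -
  define A where "A = {i \<in> {0..n}. (\<exists>j. i = j * (j + 1)) \<and> (\<exists>k>0. n - i = d * (k * k))}"
  have "(pronic_fps * Abs_fps (\<lambda>m. if \<exists>k>0. m = d * (k * k) then 1 else 0)) $ n =
    (\<Sum>i=0..n. if i \<in> A then 1 else 0)"
    unfolding fps_mult_nth by (intro sum.cong) (auto simp: pronic_fps_def A_def)
  also have "\<dots> = int (card A)"
    by (subst sum.inter_filter[symmetric]) (auto simp: A_def)
  also have "card A = card (pronic_reps d n)"
  proof (rule bij_betw_same_card[symmetric])
    have "inj_on (\<lambda>(j, k). j * (j + 1)) (pronic_reps d n)"
      using assms pronic_eq_iff
      by (auto simp: inj_on_def pronic_reps_def simp del: mult_Suc_right add_2_eq_Suc' )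
        (metis add_left_cancel mult_cancel1 not_gr_zero power2_eq_square power2_eq_iff_nonneg zero_le)+
    moreover have "(\<lambda>(j, k). j * (j + 1)) ` pronic_reps d n = A"
      using assms by (force simp: pronic_reps_def A_def image_iff)
    ultimately show "bij_betw (\<lambda>(j, k). j * (j + 1)) (pronic_reps d n) A"
      by (simp add: bij_betw_def)
  qed
  finally show ?thesis .
qed

text \<open>Pronic numbers are even, so all contributions to the coefficient at \<open>n\<close>
  carry the same sign.\<close>

lemma pronic_times_square_coeff:
  "(pronic_fps * alternating_square_fps) $ n = (-1) ^ n * int (card (pronic_reps 1 n))"
proof -
  have "(pronic_fps * alternating_square_fps) $ n = (-1) ^ n *
    (pronic_fps * Abs_fps (\<lambda>m. if \<exists>k>0. m = 1 * (k * k) then 1 else 0)) $ n"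
    unfolding fps_mult_nth sum_distrib_left
  proof (intro sum.cong refl)
    fix i assume i: "i \<in> {0..n}"
    have "(-1) ^ (n - i) = ((-1) ^ n :: int)" if "\<exists>j. i = j * (j + 1)"
    proof -
      have "even i" using that by auto
      with i show ?thesis by (simp add: minus_one_power_iff)
    qed
    then show "pronic_fps $ i * alternating_square_fps $ (n - i) = (-1) ^ n * (pronic_fps $ i *
      Abs_fps (\<lambda>m. if \<exists>k>0. m = 1 * (k * k) then 1 else 0) $ (n - i))"
      unfolding pronic_fps_def alternating_square_fps_def fps_nth_Abs_fps mult_1_left
      by (simp only: split: if_split) simp
  qed
  then show ?thesis by (simp only: pronic_times_indicator_coeff zero_less_one)
qed

text \<open>Modulo 8 the series is
  \<open>pronic_fps + 6 * (pronic_fps * S) + 4 * (pronic_fps * Q)\<close>; the three assumptions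
  make the coefficient at \<open>n\<close> of each summand vanish modulo 8.\<close>

lemma ped_minus2_cong_8:
  assumes "\<nexists>j. n = j * (j + 1)" "4 dvd card (pronic_reps 1 n)" "even (card (pronic_reps 2 n))"
  shows "[ped_minus2 n = 0] (mod 8)"
proof -
  define G where "G = Abs_fps (\<lambda>n. int (ped_minus2 n))"
  define S where "S = alternating_square_fps"
  \<comment> \<open>\<open>Q\<close> is \<open>S\<close> at the squared variable with its signs
    dropped. The signs do not matter modulo 2, where \<open>S * S\<close> agrees with
    \<open>Q\<close>; \<open>H\<close> is half of the difference.\<close>
  define Q where "Q = Abs_fps (\<lambda>m. if \<exists>k>0. m = 2 * (k * k) then 1 else 0 :: int)"
  define H where "H = Abs_fps (\<lambda>m. ((S * S) $ m - Q $ m) div 2)"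
  have "even ((S * S) $ m - Q $ m)" for m
  proof -
    have "Q $ m = (if even m then \<bar>S $ (m div 2)\<bar> else 0)"
    proof (cases "\<exists>k>0. m = 2 * (k * k)")
      case True
      then have "even m" "\<exists>k>0. m div 2 = k * k" by auto
      then show ?thesis using True by (simp only: Q_def S_def alternating_square_fps_def fps_nth_Abs_fps) simp
    next
      case False
      then have "\<not> (even m \<and> (\<exists>k>0. m div 2 = k * k))"
        by (metis dvd_mult_div_cancel)
      then have "(if even m then \<bar>S $ (m div 2)\<bar> else 0) = 0"
        by (cases "even m") (auto simp: S_def alternating_square_fps_def)
      moreover have "Q $ m = 0" using False by (simp add: Q_def)
      ultimately show ?thesis by simp
    qed
    then have "[Q $ m = (if even m then S $ (m div 2) else 0)] (mod 2)"
      by (auto simp: cong_iff_dvd_diff)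
    with square_coeff_mod2[of S m] show ?thesis
      by (metis cong_iff_dvd_diff cong_sym cong_trans)
  qed
  then have SS: "S * S = Q + 2 * H"
    by (intro fps_ext) (simp add: H_def numeral_fps_const)
  have G: "G * (1 + 2 * S) = pronic_fps"
    unfolding G_def S_def by (rule ped_fps_times_theta)
  \<comment> \<open>Division by \<open>1 + 2 * S\<close> is replaced by multiplication with its
    cube: the fourth power \<open>(1 + 2 * S) ^ 4\<close> is 1 plus 8 times the bracket on the
    left.\<close>
  have "G + 8 * (G * (S + 3 * (S * S) + 4 * (S * S * S) + 2 * (S * S * S * S))) =
    G * (1 + 2 * S) * ((1 + 2 * S) * (1 + 2 * S) * (1 + 2 * S))"
    by (simp add: algebra_simps)
  also have "\<dots> = pronic_fps + 6 * (pronic_fps * S) + 4 * (pronic_fps * (S * S))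
    + 8 * (pronic_fps * (S * S + S * S * S))"
    unfolding G by (simp add: algebra_simps)
  also have "\<dots> = pronic_fps + 6 * (pronic_fps * S) + 4 * (pronic_fps * Q)
    + 8 * (pronic_fps * (H + S * S + S * S * S))"
    unfolding SS by (simp add: algebra_simps)
  finally have e: "G + 8 * (G * (S + 3 * (S * S) + 4 * (S * S * S) + 2 * (S * S * S * S))) =
    pronic_fps + 6 * (pronic_fps * S) + 4 * (pronic_fps * Q)
    + 8 * (pronic_fps * (H + S * S + S * S * S))" .
  have "g + 8 * u = c + 8 * v \<Longrightarrow> g = c + 8 * (v - u)" for g u c v :: "int fps"
    by (simp add: algebra_simps)
  from this[OF e] obtain J
    where J: "G = pronic_fps + 6 * (pronic_fps * S) + 4 * (pronic_fps * Q) + 8 * J"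
    by blast
  have 1: "pronic_fps $ n = 0" using assms(1) by (auto simp: pronic_fps_def)
  have 2: "(pronic_fps * S) $ n = (-1) ^ n * int (card (pronic_reps 1 n))"
    unfolding S_def by (rule pronic_times_square_coeff)
  have 3: "(pronic_fps * Q) $ n = int (card (pronic_reps 2 n))"
    unfolding Q_def by (rule pronic_times_indicator_coeff) simp
  have "int (ped_minus2 n) = G $ n" by (simp add: G_def)
  also have "\<dots> = 6 * ((-1) ^ n * int (card (pronic_reps 1 n))) + 4 * int (card (pronic_reps 2 n)) + 8 * J $ n"
    unfolding J by (simp add: numeral_fps_const 1 2[unfolded numeral_fps_const] 3)
  finally have e: "int (ped_minus2 n) =
    6 * ((-1) ^ n * int (card (pronic_reps 1 n))) + 4 * int (card (pronic_reps 2 n)) + 8 * J $ n" .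
  obtain u v where "card (pronic_reps 1 n) = 4 * u" "card (pronic_reps 2 n) = 2 * v"
    using assms(2,3) by (auto elim!: dvdE)
  with e have "int (ped_minus2 n) = 8 * (3 * (-1) ^ n * int u + int v + J $ n)"
    by (simp add: algebra_simps)
  then have "int 8 dvd int (ped_minus2 n)" by simp
  then show ?thesis unfolding int_dvd_int_iff cong_0_iff .
qed

section \<open>Representations by \<open>x^2 + d y^2\<close>\<close>

definition form_reps :: "int \<Rightarrow> int \<Rightarrow> (int \<times> int) set" where
  "form_reps d m = {(x, y). x * x + d * (y * y) = m}"

lemma finite_form_reps:
  assumes "d > 0"
  shows "finite (form_reps d m)"
proof -
  have b: "z \<in> {-m..m}" if "z * z \<le> m" for z :: int
  proof -
    have "\<bar>z\<bar> \<le> z * z"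
      by (metis abs_mult_self_eq mult_left_mono abs_ge_zero int_one_le_iff_zero_less mult.right_neutral
          mult_zero_left order.refl zero_less_abs_iff abs_0)
    with that show ?thesis by auto
  qed
  have "form_reps d m \<subseteq> {-m..m} \<times> {-m..m}"
  proof
    fix z assume "z \<in> form_reps d m"
    then obtain x y where z: "z = (x, y)" and m: "x * x + d * (y * y) = m"
      by (auto simp: form_reps_def)
    have "1 * (y * y) \<le> d * (y * y)"
      using assms by (intro mult_right_mono) auto
    moreover have "0 \<le> x * x" "0 \<le> d * (y * y)"
      using assms by auto
    ultimately have "x * x \<le> m" "y * y \<le> m"
      using m by linarith+
    then show "z \<in> {-m..m} \<times> {-m..m}" using b z by blast
  qed
  then show ?thesis by (rule finite_subset) simp
qed

section \<open>Counting up to signs, and multiplication by a represented prime\<close>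

lemma card_eq_two_halves:
  assumes "finite A" "A = B \<union> f ` B" "B \<inter> f ` B = {}" "inj_on f B"
  shows "card A = 2 * card B"
proof -
  have "finite B" using assms(1,2) by auto
  then have "card A = card B + card (f ` B)"
    using assms(2,3) by (simp add: card_Un_disjoint)
  then show ?thesis using card_image[OF assms(4)] by simp
qed

lemma card_eq_two_times_positive_fst:
  fixes A :: "(int \<times> int) set"
  assumes "finite A" "\<And>x y. (x, y) \<in> A \<Longrightarrow> (-x, y) \<in> A \<and> x \<noteq> 0"
  shows "card A = 2 * card {(x, y) \<in> A. x > 0}"
proof (rule card_eq_two_halves[where f = "\<lambda>(x, y). (-x, y)"])
  show "A = {(x, y) \<in> A. x > 0} \<union> (\<lambda>(x, y). (-x, y)) ` {(x, y) \<in> A. x > 0}"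
  proof (intro equalityI subsetI)
    fix z assume z: "z \<in> A"
    obtain x y where xy: "z = (x, y)" by (cases z)
    with z assms(2)[of x y] have "x > 0 \<or> (-x, y) \<in> {(x, y) \<in> A. x > 0}" by auto
    with z xy show "z \<in> {(x, y) \<in> A. x > 0} \<union> (\<lambda>(x, y). (-x, y)) ` {(x, y) \<in> A. x > 0}"
      by (auto simp: image_iff intro!: bexI[of _ "(-x, y)"])
  qed (use assms(2) in auto)
qed (use assms(1) in \<open>auto simp: inj_on_def\<close>)

lemma card_eq_four_times_quadrant:
  fixes A :: "(int \<times> int) set"
  assumes "finite A" "\<And>x y. (x, y) \<in> A \<Longrightarrow> (-x, y) \<in> A \<and> (x, -y) \<in> A \<and> x \<noteq> 0 \<and> y \<noteq> 0"
  shows "card A = 4 * card {(x, y) \<in> A. x > 0 \<and> y > 0}"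
proof -
  define B where "B = {(x, y) \<in> A. x > 0}"
  have fin: "finite B" unfolding B_def using assms(1) by (rule rev_finite_subset) auto
  have "card A = 2 * card B"
    unfolding B_def using assms by (intro card_eq_two_times_positive_fst) auto
  \<comment> \<open>Swapping the coordinates lets the halving by the sign of the first coordinate be
    applied to the second one.\<close>
  moreover have "card B = card (prod.swap ` B)"
    by (simp add: card_image)
  moreover have "card (prod.swap ` B) = 2 * card {(x, y) \<in> prod.swap ` B. x > 0}"
    using assms fin by (intro card_eq_two_times_positive_fst) (force simp: B_def)+
  moreover have "{(x, y) \<in> prod.swap ` B. x > 0} = prod.swap ` {(x, y) \<in> A. x > 0 \<and> y > 0}"
    by (force simp: B_def)
  ultimately show ?thesis by (simp add: card_image)
qed

text \<open>The divisibility condition singles out the multiples of \<open>a + b \<surd>(-d)\<close>.\<close>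

lemma card_form_reps_divisible:
  fixes p :: int
  assumes p: "prime p" "p = a * a + d * (b * b)"
  shows "card {(x, y) \<in> form_reps d (p * m). p dvd a * y - b * x} = card (form_reps d m)"
proof (rule bij_betw_same_card)
  \<comment> \<open>With \<open>(x, y)\<close> read as \<open>x + y * sqrt(-d)\<close>,
    \<open>?g\<close> multiplies by \<open>a + b * sqrt(-d)\<close> and \<open>?f\<close> divides by
    it, that is, multiplies by the conjugate and divides by \<open>p\<close>.\<close>
  let ?f = "\<lambda>(x, y). ((a * x + d * b * y) div p, (a * y - b * x) div p)"
  let ?g = "\<lambda>(x, y). (a * x - d * b * y, a * y + b * x)"
  let ?A = "{(x, y) \<in> form_reps d (p * m). p dvd a * y - b * x}"
  have p0: "p \<noteq> 0" using p(1) by auto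
  have A: "\<exists>u v. a * x + d * b * y = p * u \<and> a * y - b * x = p * v \<and> (u, v) \<in> form_reps d m \<and>
      x = a * u - d * b * v \<and> y = a * v + b * u"
    if "x * x + d * (y * y) = p * m" "p dvd a * y - b * x" for x y
  proof -
    \<comment> \<open>Multiplicativity of the norm: once \<open>p\<close> divides
      \<open>a * y - b * x\<close>, it divides the square of \<open>a * x + d * b * y\<close>, so
      both coordinates of \<open>?f\<close> are exact quotients.\<close>
    have "(a * x + d * b * y) * (a * x + d * b * y) + d * ((a * y - b * x) * (a * y - b * x)) =
        p * (x * x + d * (y * y))"
      by (simp add: p(2) algebra_simps)
    then have id: "(a * x + d * b * y) * (a * x + d * b * y) + d * ((a * y - b * x) * (a * y - b * x)) = p * (p * m)"
      using that(1) by simp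
    then have "(a * x + d * b * y) * (a * x + d * b * y) = p * (p * m) - d * ((a * y - b * x) * (a * y - b * x))"
      by simp
    moreover have "p dvd p * (p * m) - d * ((a * y - b * x) * (a * y - b * x))"
      using that(2) by (intro dvd_diff) auto
    ultimately have "p dvd a * x + d * b * y"
      using p(1) by (metis prime_dvd_mult_iff)
    then obtain u where u: "a * x + d * b * y = p * u" by (rule dvdE)
    from that(2) obtain v where "a * y - b * x = p * v" by (rule dvdE)
    note uv = u this
    have "p * p * (u * u + d * (v * v)) = p * p * m"
      using id unfolding uv by (simp add: algebra_simps)
    then have "u * u + d * (v * v) = m" using p0 by simp
    moreover have "p * x = p * (a * u - d * b * v)"
    proof -
      have "p * x = a * (a * x + d * b * y) - d * b * (a * y - b * x)"
        by (simp add: p(2) algebra_simps)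
      then show ?thesis unfolding uv by (simp add: algebra_simps)
    qed
    moreover have "p * y = p * (a * v + b * u)"
    proof -
      have "p * y = a * (a * y - b * x) + b * (a * x + d * b * y)"
        by (simp add: p(2) algebra_simps)
      then show ?thesis unfolding uv by (simp add: algebra_simps)
    qed
    ultimately show ?thesis using uv p0 by (auto simp: form_reps_def)
  qed
  have B: "a * (a * x - d * b * y) + d * b * (a * y + b * x) = p * x"
    "a * (a * y + b * x) - b * (a * x - d * b * y) = p * y" for x y
    by (simp_all add: p(2) algebra_simps)
  have C: "(a * x - d * b * y) * (a * x - d * b * y) + d * ((a * y + b * x) * (a * y + b * x))
    = p * (x * x + d * (y * y))" for x y
    by (simp add: p(2) algebra_simps)
  have D: "?f z \<in> form_reps d m \<and> ?g (?f z) = z" if "z \<in> ?A" for z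
  proof -
    from that obtain x y where z: "z = (x, y)" "x * x + d * (y * y) = p * m" "p dvd a * y - b * x"
      by (auto simp: form_reps_def)
    from A[OF z(2,3)] obtain u v where uv: "a * x + d * b * y = p * u" "a * y - b * x = p * v"
      and "(u, v) \<in> form_reps d m" "x = a * u - d * b * v" "y = a * v + b * u"
      by blast
    moreover have "?f z = (u, v)" using p0 by (simp add: z(1) uv)
    ultimately show ?thesis using z(1) by simp
  qed
  show "bij_betw ?f ?A (form_reps d m)"
  proof (rule bij_betw_byWitness[where f' = ?g])
    show "\<forall>z\<in>form_reps d m. ?f (?g z) = z"
      using p0 by (simp add: B split: prod.split)
    show "?g ` form_reps d m \<subseteq> ?A"
    proof
      fix z assume "z \<in> ?g ` form_reps d m"
      then obtain x y where "x * x + d * (y * y) = m" "z = (a * x - d * b * y, a * y + b * x)"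
        by (auto simp: form_reps_def)
      then show "z \<in> ?A" using B(2)[of y x] C[of x y] by (simp add: form_reps_def)
    qed
  qed (use D in blast)+
qed

text \<open>Inclusion-exclusion: every representation of \<open>p * m\<close> is divisible by
  \<open>a + b * sqrt(-d)\<close> (set \<open>A\<close>) or by its conjugate (set \<open>B\<close>),
  and by both exactly when \<open>p\<close> divides \<open>x\<close> and \<open>y\<close>. Each of
  the two sets is in bijection with the representations of \<open>m\<close>.\<close>

lemma card_form_reps_times_prime:
  fixes p :: int
  assumes p: "prime p" "p = a * a + d * (b * b)" "odd p" "\<not> p dvd a" "\<not> p dvd b" and d: "d > 0"
  shows "card (form_reps d (p * m)) + card {(x, y) \<in> form_reps d (p * m). p dvd x \<and> p dvd y} =
    2 * card (form_reps d m)"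
proof -
  let ?R = "form_reps d (p * m)"
  define A where "A = {(x, y) \<in> ?R. p dvd a * y - b * x}"
  define B where "B = {(x, y) \<in> ?R. p dvd a * y - (-b) * x}"
  have cA: "card A = card (form_reps d m)"
    unfolding A_def using p by (intro card_form_reps_divisible) auto
  have cB: "card B = card (form_reps d m)"
    unfolding B_def using p by (intro card_form_reps_divisible) auto
  have "finite A" "finite B"
    by (rule finite_subset[OF _ finite_form_reps[OF d, of "p * m"]]; force simp: A_def B_def)+
  then have "card A + card B = card (A \<union> B) + card (A \<inter> B)"
    by (rule card_Un_Int)
  moreover have "A \<union> B = ?R"
  proof -
    have "p dvd a * y - b * x \<or> p dvd a * y - (-b) * x" if "x * x + d * (y * y) = p * m" for x y
    proof -
      have "(a * y - b * x) * (a * y - (-b) * x) = p * (y * y) - b * b * (x * x + d * (y * y))"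
        by (simp add: p(2) algebra_simps)
      then have "p dvd (a * y - b * x) * (a * y - (-b) * x)"
        unfolding that by simp
      then show ?thesis using p(1) prime_dvd_mult_iff by blast
    qed
    then show ?thesis by (auto simp: A_def B_def form_reps_def)
  qed
  moreover have "A \<inter> B = {(x, y) \<in> ?R. p dvd x \<and> p dvd y}"
  proof -
    have "p dvd x \<and> p dvd y" if "p dvd a * y - b * x" "p dvd a * y - (-b) * x" for x y
    proof -
      have "p dvd 2 * (a * y)" "p dvd 2 * (b * x)"
        using dvd_add[OF that] dvd_diff[OF that(2,1)] by (simp_all add: algebra_simps)
      moreover have "\<not> p dvd 2"
        using p(1,3) prime_gt_1_int[of p] zdvd_imp_le[of p 2] by (cases "p = 2") auto
      ultimately show ?thesis using p(1,4,5) by (simp add: prime_dvd_mult_iff)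
    qed
    moreover have "p dvd a * y - b * x" "p dvd a * y - (-b) * x" if "p dvd x" "p dvd y" for x y
      using that by simp_all
    ultimately show ?thesis unfolding A_def B_def by blast
  qed
  ultimately show ?thesis using cA cB by simp
qed

lemma card_form_reps_common_factor:
  fixes p :: int
  assumes "p \<noteq> 0"
  shows "card {(x, y) \<in> form_reps d (p * (p * m)). p dvd x \<and> p dvd y} = card (form_reps d m)"
proof (rule bij_betw_same_card[symmetric])
  have eq: "p * x * (p * x) + d * (p * y * (p * y)) = p * (p * m) \<longleftrightarrow> x * x + d * (y * y) = m" for x y
  proof -
    have "p * x * (p * x) + d * (p * y * (p * y)) = p * (p * (x * x + d * (y * y)))"
      by (simp add: algebra_simps)
    then show ?thesis using assms by simp
  qed
  show "bij_betw (\<lambda>(x, y). (p * x, p * y)) (form_reps d m)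
    {(x, y) \<in> form_reps d (p * (p * m)). p dvd x \<and> p dvd y}"
    unfolding bij_betw_def
  proof
    show "inj_on (\<lambda>(x, y). (p * x, p * y)) (form_reps d m)"
      using assms by (auto simp: inj_on_def)
    show "(\<lambda>(x, y). (p * x, p * y)) ` form_reps d m =
      {(x, y) \<in> form_reps d (p * (p * m)). p dvd x \<and> p dvd y}"
      using eq by (force simp: form_reps_def elim!: dvdE)
  qed
qed

lemma square_dvd_form:
  fixes p :: int
  assumes "p dvd x" "p dvd y"
  shows "p * p dvd x * x + d * (y * y)"
  using assms by (intro dvd_add dvd_mult mult_dvd_mono)

text \<open>Writing \<open>c k\<close> for the count at exponent \<open>k\<close>, the two preceding
  counts give \<open>c (k + 2) + c k = 2 * c (k + 1)\<close>, and \<open>c 1 = 2 * c 0\<close>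
  because \<open>p * p\<close> does not divide \<open>p * m\<close>. So the counts form an
  arithmetic progression.\<close>

lemma card_form_reps_prime_power:
  fixes p :: int
  assumes p: "prime p" "p = a * a + d * (b * b)" "odd p" "\<not> p dvd a" "\<not> p dvd b" and d: "d > 0"
    and m: "\<not> p dvd m"
  shows "card (form_reps d (p ^ k * m)) = (k + 1) * card (form_reps d m)"
proof (induction k rule: induct_nat_012)
  case 0
  show ?case by simp
next
  case 1
  have "p \<noteq> 0" using p(1) by auto
  have "{(x, y) \<in> form_reps d (p * m). p dvd x \<and> p dvd y} = {}"
  proof -
    have "p dvd m" if "p dvd x" "p dvd y" "x * x + d * (y * y) = p * m" for x y
      using square_dvd_form[OF that(1,2), of d] that(3) \<open>p \<noteq> 0\<close> by simp
    then show ?thesis using m by (auto simp: form_reps_def)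
  qed
  then show ?case
    using card_form_reps_times_prime[OF p d, of m] by (simp only: card.empty) simp
next
  case (ge2 k)
  have "p \<noteq> 0" using p(1) by auto
  then show ?case
    using card_form_reps_times_prime[OF p d, of "p * (p ^ k * m)"] ge2
      card_form_reps_common_factor[of p d "p ^ k * m"]
    by (simp add: algebra_simps)
qed

section \<open>Thue's argument, and primes that are not represented\<close>

lemma ex_nat_sqrt: "\<exists>t :: nat. t * t \<le> n \<and> n < (t + 1) * (t + 1)"
proof (induction n)
  case (Suc n)
  then obtain t where t: "t * t \<le> n" "n < (t + 1) * (t + 1)" by blast
  show ?case
  proof (cases "Suc n < (t + 1) * (t + 1)")
    case True
    with t show ?thesis by (intro exI[of _ t]) simp
  next
    case False
    with t have "Suc n = (t + 1) * (t + 1)" by simp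
    then show ?thesis by (intro exI[of _ "t + 1"]) simp
  qed
qed simp

lemma prime_not_square:
  fixes p z :: int
  assumes "prime p"
  shows "z * z \<noteq> p"
proof
  assume "z * z = p"
  then have "p dvd z * z" by simp
  then have "p dvd z" using prime_dvd_mult_iff[OF assms] by blast
  then obtain k where "z = p * k" by (rule dvdE)
  with \<open>z * z = p\<close> have "p * (p * k * k) = p * 1" by (simp add: ac_simps)
  then have "p * (k * k) = 1" using assms by (simp add: ac_simps)
  then have "p dvd 1" by (metis dvd_triv_left)
  then show False using assms not_prime_unit by blast
qed

text \<open>There are more than \<open>p\<close> pairs with entries in \<open>{0..s}\<close>, where
  \<open>s\<close> is the integer square root of \<open>p\<close>, so two of them collide under
  \<open>f\<close>. Their difference \<open>(a, b)\<close> has both squares below \<open>p\<close>,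
  and \<open>p\<close> divides \<open>a * a + d * (b * b)\<close>; the quotient \<open>q\<close> is
  therefore at most \<open>d\<close>. If \<open>q = d = 2\<close>, then \<open>a\<close> is even and
  halving it turns the equation into a representation of \<open>p\<close>.\<close>

lemma thue_representation:
  fixes p :: int
  assumes p: "prime p" "odd p" and d: "d = 1 \<or> d = 2"
    and dvd: "p dvd x * x + d * (y * y)" and y: "\<not> p dvd y"
  shows "\<exists>a b. p = a * a + d * (b * b)"
proof -
  have p0: "p > 0" using p(1) by (simp add: prime_gt_0_int)
  obtain t :: nat where "t * t \<le> nat p" "nat p < (t + 1) * (t + 1)"
    using ex_nat_sqrt by blast
  then have "int (t * t) \<le> p" "p < int ((t + 1) * (t + 1))"
    using p0 by (simp_all only: le_nat_iff nat_less_iff less_imp_le)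
  moreover define s where "s = int t"
  ultimately have s: "s \<ge> 0" "s * s \<le> p" "p < (s + 1) * (s + 1)"
    by (simp_all add: algebra_simps)
  define f where "f = (\<lambda>(i, j). (i * y - j * x) mod p)"
  define A where "A = {0..s} \<times> {0..s}"
  have "f ` A \<subseteq> {0..<p}" using p0 by (auto simp: f_def)
  then have "card (f ` A) \<le> nat p"
    using card_mono[of "{0..<p}" "f ` A"] by simp
  also have "nat p < nat ((s + 1) * (s + 1))"
    using s p0 by (simp only: nat_less_eq_zless less_imp_le)
  also have "\<dots> = card A"
    using s(1) by (simp add: A_def card_cartesian_product nat_mult_distrib)
  finally have "\<not> inj_on f A" by (rule pigeonhole)
  then obtain i j i' j' where ij: "(i, j) \<in> A" "(i', j') \<in> A" "(i, j) \<noteq> (i', j')" "f (i, j) = f (i', j')"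
    by (auto simp: inj_on_def)
  define a b where "a = i - i'" and "b = j - j'"
  have ab: "\<bar>a\<bar> \<le> s" "\<bar>b\<bar> \<le> s" "a \<noteq> 0 \<or> b \<noteq> 0"
    using ij by (auto simp: A_def a_def b_def)
  have "p dvd a * y - b * x"
    using ij(4) by (simp add: f_def mod_eq_dvd_iff a_def b_def algebra_simps)
  moreover have "y * y * (a * a + d * (b * b)) =
      (a * y - b * x) * (a * y + b * x) + b * b * (x * x + d * (y * y))"
    by (simp add: algebra_simps)
  ultimately have "p dvd y * y * (a * a + d * (b * b))"
    using dvd by simp
  then have "p dvd a * a + d * (b * b)"
    using p(1) y by (metis prime_dvd_mult_iff)
  then obtain q where q: "a * a + d * (b * b) = p * q" by (auto elim: dvdE)
  have sq: "z * z < p" if "\<bar>z\<bar> \<le> s" for z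
  proof -
    have "z * z \<le> s * s" using that s(1) by (metis abs_mult_self_eq abs_ge_zero mult_mono)
    then show ?thesis using s(2) prime_not_square[OF p(1), of s] by linarith
  qed
  have dpos: "d > 0" using d by auto
  have pos: "0 < z * z" if "z \<noteq> 0" for z :: int
    using that by (cases "z > 0") (auto intro: mult_pos_pos mult_neg_neg)
  have "0 < a * a + d * (b * b)"
  proof (cases "a = 0")
    case True
    with ab(3) dpos have "0 < d * (b * b)" by (intro mult_pos_pos pos) auto
    then show ?thesis using True by simp
  next
    case False
    then have "0 < a * a" by (rule pos)
    moreover have "0 \<le> d * (b * b)" using dpos by simp
    ultimately show ?thesis by linarith
  qed
  then have "0 < p * q" by (simp only: q)
  then have "q > 0" using p0 by (simp add: zero_less_mult_iff)
  have "a * a + d * (b * b) < p * (d + 1)"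
    using sq[OF ab(1)] sq[OF ab(2)] d by auto
  then have "q < d + 1" using p0 by (simp only: q mult_less_cancel_left_pos)
  with \<open>q > 0\<close> d have "q = 1 \<or> q = 2 \<and> d = 2" by arith
  then consider "q = 1" | "q = 2" "d = 2" by blast
  then show ?thesis
  proof cases
    case 1
    then show ?thesis using q by auto
  next
    case 2
    then have "a * a = 2 * (p - b * b)" using q by simp
    then have "even a" by (metis even_mult_iff dvd_triv_left)
    then obtain c where "a = 2 * c" by (auto elim: evenE)
    then have "p = b * b + d * (c * c)" using q 2 by simp
    then show ?thesis by blast
  qed
qed

text \<open>By Thue's argument, \<open>p\<close> dividing a value of the form must divide both
  coordinates. So \<open>p * p\<close> can be split off until the exponent is 1, where
  \<open>p * p\<close> would have to divide \<open>p * m\<close>.\<close>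

lemma form_reps_odd_prime_power_empty:
  fixes p :: int
  assumes p: "prime p" "odd p" and d: "d = 1 \<or> d = 2"
    and nrep: "\<nexists>a b. p = a * a + d * (b * b)" and m: "\<not> p dvd m"
  shows "form_reps d (p ^ (2 * e + 1) * m) = {}"
proof -
  have p0: "p \<noteq> 0" using p(1) by auto
  have div: "p dvd x \<and> p dvd y" if "p dvd x * x + d * (y * y)" for x y
  proof -
    have "p dvd y" using thue_representation[OF p d that] nrep by blast
    moreover from this have "p dvd x * x"
      using that by (simp add: dvd_add_left_iff)
    ultimately show ?thesis using p(1) by (simp add: prime_dvd_mult_iff)
  qed
  show ?thesis
  proof (induction e)
    case 0
    have "False" if "(x, y) \<in> form_reps d (p * m)" for x y
    proof -
      from that have e: "x * x + d * (y * y) = p * m" by (simp add: form_reps_def)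
      then have "p * p dvd p * m" using div[of x y] square_dvd_form[of p x y d] by simp
      then show False using m p0 by simp
    qed
    then show ?case by auto
  next
    case (Suc e)
    have p2: "p ^ (2 * Suc e + 1) * m = p * (p * (p ^ (2 * e + 1) * m))"
      by (simp add: algebra_simps)
    let ?R = "form_reps d (p * (p * (p ^ (2 * e + 1) * m)))"
    have "p dvd x \<and> p dvd y" if "(x, y) \<in> ?R" for x y
    proof (rule div)
      show "p dvd x * x + d * (y * y)" using that unfolding form_reps_def by simp
    qed
    then have "{(x, y) \<in> ?R. p dvd x \<and> p dvd y} = ?R" by blast
    then have "card ?R = 0"
      using card_form_reps_common_factor[OF p0, of d "p ^ (2 * e + 1) * m"] Suc.IH by simp
    moreover have "finite ?R" using d by (intro finite_form_reps) auto
    ultimately show ?case unfolding p2 by simp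
  qed
qed

text \<open>In a representation of \<open>p\<close> both \<open>a\<close> and \<open>b\<close> are
  nonzero, since \<open>p\<close> is odd and no square, and their squares are at most
  \<open>p\<close>. Hence \<open>p\<close> divides neither, as the count for prime powers
  requires.\<close>

lemma card_form_reps_odd_prime_power:
  fixes p :: int
  assumes p: "prime p" "odd p" and d: "d = 1 \<or> d = 2" and m: "\<not> p dvd m"
  obtains "card (form_reps d (p ^ (2 * e + 1) * m)) = 0"
  | a b where "p = a * a + d * (b * b)"
      "card (form_reps d (p ^ (2 * e + 1) * m)) = (2 * e + 2) * card (form_reps d m)"
proof (cases "\<exists>a b. p = a * a + d * (b * b)")
  case False
  then show ?thesis using form_reps_odd_prime_power_empty[OF p d False m] that(1) by simp
next
  case True
  then obtain a b where ab: "p = a * a + d * (b * b)" by blast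
  have p1: "p > 1" using p(1) by (simp add: prime_gt_1_int)
  have small: "\<not> p dvd z" if "z \<noteq> 0" "z * z \<le> p" for z
  proof
    assume "p dvd z"
    then have "p \<le> \<bar>z\<bar>" using that(1) p1 dvd_imp_le_int[of z p] by simp
    then have "p * p \<le> \<bar>z\<bar> * \<bar>z\<bar>" using p1 by (intro mult_mono) auto
    then have "p * p \<le> p * 1" using that(2) by simp
    with p1 show False by simp
  qed
  have "a \<noteq> 0"
  proof
    assume "a = 0"
    with ab d p(2) prime_not_square[OF p(1), of b] show False by auto
  qed
  have "b \<noteq> 0"
    using ab prime_not_square[OF p(1), of a] by auto
  have "b * b \<le> d * (b * b)" using d by auto
  moreover have "0 \<le> a * a" "0 \<le> d * (b * b)" using d by auto
  ultimately have "a * a \<le> p" "b * b \<le> p" unfolding ab by linarith+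
  then have "\<not> p dvd a" "\<not> p dvd b" using small[of a] small[of b] \<open>a \<noteq> 0\<close> \<open>b \<noteq> 0\<close> by simp_all
  moreover have "d > 0" using d by auto
  ultimately show ?thesis
    using card_form_reps_prime_power[OF p(1) ab p(2) _ _ _ m, of "2 * e + 1"] that(2)[OF ab] by simp
qed

section \<open>The congruences\<close>

lemma card_pronic_reps:
  assumes d: "d = 1 \<or> d = 2"
  shows "card (pronic_reps d n) =
    card {(x, y) \<in> form_reps (int d) (4 * int n + 1). odd x \<and> x > 0 \<and> y > 0}"
proof (rule bij_betw_same_card)
  let ?f = "\<lambda>(j, k). (2 * int j + 1, 2 * int k)"
  let ?B = "{(x, y) \<in> form_reps (int d) (4 * int n + 1). odd x \<and> x > 0 \<and> y > 0}"
  have eq: "(2 * int j + 1) * (2 * int j + 1) + int d * (2 * int k * (2 * int k)) = 4 * int n + 1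
    \<longleftrightarrow> j * (j + 1) + d * (k * k) = n" for j k
  proof -
    have "(2 * int j + 1) * (2 * int j + 1) + int d * (2 * int k * (2 * int k)) =
      4 * int (j * (j + 1) + d * (k * k)) + 1"
      by (simp add: algebra_simps)
    then show ?thesis by (simp only: add_right_cancel mult_cancel_left of_nat_eq_iff) simp
  qed
  have surj: "\<exists>j k. (j, k) \<in> pronic_reps d n \<and> x = 2 * int j + 1 \<and> y = 2 * int k"
    if xy: "x * x + int d * (y * y) = 4 * int n + 1" "odd x" "x > 0" "y > 0" for x y
  proof -
    obtain i where i: "x = 2 * i + 1" using xy(2) by (rule oddE)
    with xy(3) have "i \<ge> 0" by simp
    then obtain j where j: "x = 2 * int j + 1" using i by (metis nonneg_int_cases)
    have dy: "int d * (y * y) = 4 * (int n - int j * (int j + 1))"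
      using xy(1) unfolding j by (simp add: algebra_simps)
    \<comment> \<open>Since \<open>d * y^2\<close> is divisible by 4 and \<open>d\<close> is 1 or 2,
      \<open>y\<close> is automatically even.\<close>
    have "even (y * y)"
    proof (cases "d = 1")
      case True
      then show ?thesis using dy by simp
    next
      case False
      then have "y * y = 2 * (int n - int j * (int j + 1))" using d dy by simp
      then show ?thesis by simp
    qed
    then have "even y" by simp
    then obtain l where l: "y = 2 * l" by (rule evenE)
    with xy(4) have "l \<ge> 0" "l > 0" by simp_all
    then obtain k where k: "y = 2 * int k" "k > 0" using l by (metis nonneg_int_cases of_nat_0_less_iff)
    have "j * (j + 1) + d * (k * k) = n"
      using xy(1) eq[of j k] unfolding j k by simp
    then show ?thesis using j k by (auto simp: pronic_reps_def)
  qed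
  show "bij_betw ?f (pronic_reps d n) ?B"
    unfolding bij_betw_def
  proof
    show "inj_on ?f (pronic_reps d n)" by (auto simp: inj_on_def)
    show "?f ` pronic_reps d n = ?B"
    proof
      show "?f ` pronic_reps d n \<subseteq> ?B"
        using eq by (auto simp: pronic_reps_def form_reps_def)
      show "?B \<subseteq> ?f ` pronic_reps d n"
        using surj by (fastforce simp: form_reps_def image_iff)
    qed
  qed
qed

text \<open>Exactly one coordinate is odd, and swapping moves it to the other place.\<close>

lemma card_form_reps_1_odd:
  assumes "odd m"
  shows "card (form_reps 1 m) = 2 * card {(x, y) \<in> form_reps 1 m. odd x}"
proof (rule card_eq_two_halves[where f = prod.swap])
  show "finite (form_reps 1 m)" by (rule finite_form_reps) simp
  have par: "odd x \<longleftrightarrow> even y" if "(x, y) \<in> form_reps 1 m" for x y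
  proof -
    from that have "x * x + y * y = m" by (simp add: form_reps_def)
    with assms have "odd (x * x + y * y)" by simp
    then show ?thesis by simp
  qed
  have swap: "(y, x) \<in> form_reps 1 m" if "(x, y) \<in> form_reps 1 m" for x y
    using that by (simp add: form_reps_def add.commute)
  have image: "prod.swap ` {(x, y) \<in> form_reps 1 m. odd x} = {(x, y) \<in> form_reps 1 m. odd y}"
    using swap by (auto simp: image_iff Bex_def)
  show "form_reps 1 m = {(x, y) \<in> form_reps 1 m. odd x} \<union> prod.swap ` {(x, y) \<in> form_reps 1 m. odd x}"
    unfolding image using par by blast
  show "{(x, y) \<in> form_reps 1 m. odd x} \<inter> prod.swap ` {(x, y) \<in> form_reps 1 m. odd x} = {}"
    unfolding image using par by blast
  show "inj_on prod.swap {(x, y) \<in> form_reps 1 m. odd x}" by simp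
qed

lemma four_dvd_card_form_reps_1:
  assumes "odd m"
  shows "4 dvd card (form_reps 1 m)"
proof -
  have "finite (form_reps 1 m)" by (rule finite_form_reps) simp
  then have "finite {(x, y) \<in> form_reps 1 m. odd x}"
    by (rule rev_finite_subset) auto
  then have "card {(x, y) \<in> form_reps 1 m. odd x} =
      2 * card {(x, y) \<in> {(x, y) \<in> form_reps 1 m. odd x}. x > 0}"
    by (rule card_eq_two_times_positive_fst) (auto simp: form_reps_def)
  then show ?thesis using card_form_reps_1_odd[OF assms] by simp
qed

text \<open>A number that is 3 modulo 4 is neither a square nor twice a square, so no representation
  lies on an axis and sign changes group them by four.\<close>

lemma four_dvd_card_form_reps_2:
  assumes "m mod 4 = 3"
  shows "4 dvd card (form_reps 2 m)"
proof -
  have nz: "x \<noteq> 0 \<and> y \<noteq> 0" if "x * x + 2 * (y * y) = m" for x y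
  proof -
    have "m \<noteq> x * x"
    proof
      assume "m = x * x"
      show False
      proof (cases "even x")
        case True
        then obtain c where "x = 2 * c" by (rule evenE)
        then show False using assms \<open>m = x * x\<close> by simp
      next
        case False
        then obtain c where "x = 2 * c + 1" by (rule oddE)
        then have "m = 1 + 4 * (c * c + c)" using \<open>m = x * x\<close> by (simp add: algebra_simps)
        then have "m mod 4 = 1" by (simp only: mod_mult_self2) simp
        then show False using assms by simp
      qed
    qed
    moreover have "odd m"
      using assms by presburger
    then have "m \<noteq> 2 * (y * y)" by auto
    ultimately show ?thesis using that by auto
  qed
  have "card (form_reps 2 m) = 4 * card {(x, y) \<in> form_reps 2 m. x > 0 \<and> y > 0}"
    using nz by (intro card_eq_four_times_quadrant finite_form_reps) (auto simp: form_reps_def)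
  then show ?thesis by simp
qed

lemma pronic_iff_square: "n = j * (j + 1) \<longleftrightarrow> 4 * int n + 1 = (2 * int j + 1) * (2 * int j + 1)"
proof -
  have "(2 * int j + 1) * (2 * int j + 1) = 4 * int (j * (j + 1)) + 1"
    by (simp add: algebra_simps)
  then show ?thesis by (simp only: add_right_cancel mult_cancel_left of_nat_eq_iff) simp
qed

text \<open>If \<open>n\<close> is not pronic, \<open>4 * n + 1\<close> is not a square, so both
  signs are free for odd \<open>x\<close>. This gives the factor 4 for \<open>x^2 + 2 * y^2\<close>,
  where \<open>x\<close> is always odd; for \<open>x^2 + y^2\<close> the swap doubles it.\<close>

lemma card_form_reps_pronic:
  assumes "\<nexists>j. n = j * (j + 1)"
  shows "card (form_reps 1 (4 * int n + 1)) = 8 * card (pronic_reps 1 n)"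
    and "card (form_reps 2 (4 * int n + 1)) = 4 * card (pronic_reps 2 n)"
proof -
  have ns: "x * x \<noteq> 4 * int n + 1" if "odd x" for x
  proof
    assume e: "x * x = 4 * int n + 1"
    have "odd \<bar>x\<bar>" "\<bar>x\<bar> \<ge> 0" using that by simp_all
    then obtain i where i: "\<bar>x\<bar> = 2 * i + 1" by (metis oddE)
    with \<open>\<bar>x\<bar> \<ge> 0\<close> have "i \<ge> 0" by linarith
    then obtain j where "\<bar>x\<bar> = 2 * int j + 1" using i by (metis nonneg_int_cases)
    then have "4 * int n + 1 = (2 * int j + 1) * (2 * int j + 1)"
      using e by (metis abs_mult_self_eq)
    then show False using assms pronic_iff_square by blast
  qed
  have four: "card {(x, y) \<in> form_reps d (4 * int n + 1). odd x} =
      4 * card {(x, y) \<in> form_reps d (4 * int n + 1). odd x \<and> x > 0 \<and> y > 0}" if "d > 0" for d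
  proof -
    let ?A = "{(x, y) \<in> form_reps d (4 * int n + 1). odd x}"
    have "finite ?A"
      by (rule finite_subset[OF _ finite_form_reps[OF that]]) auto
    then have "card ?A = 4 * card {(x, y) \<in> ?A. x > 0 \<and> y > 0}"
    proof (rule card_eq_four_times_quadrant)
      fix x y assume "(x, y) \<in> ?A"
      then show "(-x, y) \<in> ?A \<and> (x, -y) \<in> ?A \<and> x \<noteq> 0 \<and> y \<noteq> 0"
        using ns[of x] by (auto simp: form_reps_def)
    qed
    also have "{(x, y) \<in> ?A. x > 0 \<and> y > 0} =
      {(x, y) \<in> form_reps d (4 * int n + 1). odd x \<and> x > 0 \<and> y > 0}" by auto
    finally show ?thesis .
  qed
  show "card (form_reps 1 (4 * int n + 1)) = 8 * card (pronic_reps 1 n)"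
    using card_form_reps_1_odd[of "4 * int n + 1"] four[of 1] card_pronic_reps[of 1 n] by simp
  have "odd x" if "x * x + 2 * (y * y) = 4 * int n + 1" for x y
  proof
    assume "even x"
    then have "even (x * x + 2 * (y * y))" by simp
    then show False unfolding that by simp
  qed
  then have "form_reps 2 (4 * int n + 1) = {(x, y) \<in> form_reps 2 (4 * int n + 1). odd x}"
    by (auto simp: form_reps_def)
  then show "card (form_reps 2 (4 * int n + 1)) = 4 * card (pronic_reps 2 n)"
    using four[of 2] card_pronic_reps[of 2 n] by simp
qed

section \<open>Assembling the congruences\<close>

lemma odd_prime_power_times_coprime_not_square:
  fixes p m t :: nat
  assumes "prime p" "\<not> p dvd m"
  shows "p ^ (2 * e + 1) * m \<noteq> t * t"
proof
  assume eq: "p ^ (2 * e + 1) * m = t * t"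
  have "m \<noteq> 0" using assms(2) by (metis dvd_0_right)
  moreover have "p > 0" using assms(1) by (simp add: prime_gt_0_nat)
  ultimately have "p ^ (2 * e + 1) * m \<noteq> 0" by simp
  then have "t * t \<noteq> 0" unfolding eq .
  then have "t \<noteq> 0" by simp
  have "p \<noteq> Suc 0" using assms(1) by auto
  then have "multiplicity p (p ^ (2 * e + 1) * m) = 2 * e + 1"
    using assms \<open>m \<noteq> 0\<close>
    by (simp add: prime_elem_multiplicity_mult_distrib prime_elem_multiplicity_power_distrib
        not_dvd_imp_multiplicity_0 multiplicity_same_power' del: power_Suc)
  moreover have "multiplicity p (t * t) = 2 * multiplicity p t"
    using assms(1) \<open>t \<noteq> 0\<close> by (simp add: prime_elem_multiplicity_mult_distrib)
  ultimately have "2 * e + 1 = 2 * multiplicity p t" unfolding eq by simp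
  then show False by presburger
qed

text \<open>It suffices that 32 divides the number of representations of \<open>4 * n + 1\<close> by
  \<open>x^2 + y^2\<close> and 8 divides the number by \<open>x^2 + 2 * y^2\<close>. Each number is
  0 or \<open>2 * e + 2\<close> times the count for \<open>m\<close>.\<close>

lemma ped_minus2_cong_8_of_prime_power:
  fixes p m n :: nat
  assumes p: "prime p" "odd p" and m: "\<not> p dvd m" and n: "4 * n + 1 = p ^ (2 * e + 1) * m"
    and mod4: "[p = 3] (mod 4) \<or> 4 dvd e + 1"
  shows "[ped_minus2 n = 0] (mod 8)"
proof (rule ped_minus2_cong_8)
  have pint: "prime (int p)" "odd (int p)" "\<not> int p dvd int m" using p m by simp_all
  have n': "4 * int n + 1 = int p ^ (2 * e + 1) * int m"
    using arg_cong[OF n, of int] by simp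
  have "odd (4 * n + 1)" by simp
  then have odd_m: "odd m" unfolding n by simp
  show np: "\<nexists>j. n = j * (j + 1)"
  proof
    assume "\<exists>j. n = j * (j + 1)"
    then obtain j where "n = j * (j + 1)" by blast
    then have "p ^ (2 * e + 1) * m = (2 * j + 1) * (2 * j + 1)"
      unfolding n[symmetric] by (simp add: algebra_simps)
    then show False using odd_prime_power_times_coprime_not_square[OF p(1) m] by blast
  qed
  note c = card_form_reps_pronic[OF np, unfolded n']
  consider "[p = 3] (mod 4)" | q where "e + 1 = 4 * q" using mod4 by (auto elim: dvdE)
  note cases = this
  have sq4: "z * z mod 4 = (if even z then 0 else 1)" for z :: int
  proof (cases "even z")
    case True
    then show ?thesis by (auto elim!: evenE)
  next
    case False
    then obtain c where "z = 2 * c + 1" by (rule oddE)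
    then have "z * z = 1 + 4 * (c * c + c)" by (simp add: algebra_simps)
    then have "z * z mod 4 = 1" by (simp only: mod_mult_self2) simp
    then show ?thesis using False by simp
  qed
  show "4 dvd card (pronic_reps 1 n)"
  proof (rule card_form_reps_odd_prime_power[OF pint(1,2) _ pint(3), of 1 e])
    assume "card (form_reps 1 (int p ^ (2 * e + 1) * int m)) = 0"
    then show ?thesis using c(1) by simp
  next
    fix a b assume ab: "int p = a * a + 1 * (b * b)"
      and card: "card (form_reps 1 (int p ^ (2 * e + 1) * int m)) = (2 * e + 2) * card (form_reps 1 (int m))"
    from cases show ?thesis
    proof cases
      \<comment> \<open>A sum of two squares is never 3 modulo 4.\<close>
      case 1
      then have "int p mod 4 = 3" unfolding cong_def by presburger
      moreover have "int p mod 4 = (a * a mod 4 + b * b mod 4) mod 4"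
        unfolding ab by (simp add: mod_simps)
      ultimately show ?thesis unfolding sq4 by (auto split: if_splits)
    next
      case (2 q)
      \<comment> \<open>The factor \<open>2 * e + 2\<close> supplies 8; the missing 4 comes from the
        representations of the odd number \<open>m\<close>.\<close>
      obtain u where "card (form_reps 1 (int m)) = 4 * u"
        using four_dvd_card_form_reps_1[of "int m"] odd_m by (auto elim: dvdE)
      moreover have "2 * e + 2 = 8 * q" using 2 by simp
      ultimately have "8 * card (pronic_reps 1 n) = 8 * q * (4 * u)"
        using card c(1) by simp
      then have "card (pronic_reps 1 n) = 4 * (q * u)" by simp
      then show ?thesis by simp
    qed
  qed simp
  show "even (card (pronic_reps 2 n))"
  proof (rule card_form_reps_odd_prime_power[OF pint(1,2) _ pint(3), of 2 e])
    assume "card (form_reps 2 (int p ^ (2 * e + 1) * int m)) = 0"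
    then show ?thesis using c(2) by simp
  next
    assume card: "card (form_reps 2 (int p ^ (2 * e + 1) * int m)) = (2 * e + 2) * card (form_reps 2 (int m))"
    from cases show ?thesis
    proof cases
      case 1
      \<comment> \<open>An odd power of \<open>p\<close> is 3 modulo 4 while
        \<open>4 * n + 1\<close> is 1, so \<open>m\<close> is 3 modulo 4. Its count is then
        divisible by 4, and \<open>2 * e + 2\<close> supplies the remaining 2.\<close>
      have "[p * p = 3 * 3] (mod 4)" using 1 by (rule cong_mult[OF _ 1])
      then have "[p ^ 2 = 1] (mod 4)" by (simp add: cong_def power2_eq_square)
      then have "[(p ^ 2) ^ e = 1 ^ e] (mod 4)" by (rule cong_pow)
      then have "[p ^ (2 * e + 1) = 3] (mod 4)"
        using cong_mult[OF 1] by (fastforce simp: power_mult)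
      then have "[p ^ (2 * e + 1) * m = 3 * m] (mod 4)" by (rule cong_scalar_right)
      then have a: "(4 * n + 1) mod 4 = 3 * m mod 4" unfolding n by (simp only: cong_def)
      have b: "(4 * n + 1) mod 4 = 1" by presburger
      from trans[OF a[symmetric] b] have "m mod 4 = 3" by presburger
      then have "int (m mod 4) = 3" by simp
      then have "int m mod 4 = 3" by (simp add: zmod_int)
      then obtain u where "card (form_reps 2 (int m)) = 4 * u"
        using four_dvd_card_form_reps_2[of "int m"] by (auto elim: dvdE)
      then have "4 * card (pronic_reps 2 n) = (2 * e + 2) * (4 * u)"
        using card c(2) by simp
      then have "card (pronic_reps 2 n) = 2 * ((e + 1) * u)" by simp
      then show ?thesis by simp
    next
      case (2 q)
      then have "2 * e + 2 = 8 * q" by simp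
      then have "4 * card (pronic_reps 2 n) = 8 * q * card (form_reps 2 (int m))"
        using card c(2) by simp
      then have "card (pronic_reps 2 n) = 2 * (q * card (form_reps 2 (int m)))" by simp
      then show ?thesis by simp
    qed
  qed simp
qed

lemma coprime_arith_progression:
  fixes p r :: nat
  assumes "prime p" "gcd r p = 1"
  shows "\<not> p dvd 4 * p * n + r"
proof
  assume "p dvd 4 * p * n + r"
  moreover have "p dvd 4 * p * n" by simp
  ultimately have "p dvd r" by (simp only: dvd_add_right_iff)
  then have "p dvd gcd r p" by simp
  then show False using assms by auto
qed

text \<open>As \<open>p * p\<close> is 1 modulo 4, so is \<open>r * p ^ (2 * e + 1)\<close>; the
  subtraction and the division on natural numbers are therefore exact.\<close>

lemma four_times_index:
  fixes p r :: nat
  assumes rp: "[r * p = 1] (mod 4)" and p: "odd p"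
  shows "4 * (p ^ (2 * e + 2) * n + (r * p ^ (2 * e + 1) - 1) div 4) + 1 =
    p ^ (2 * e + 1) * (4 * p * n + r)"
proof -
  have "[p * p = 1] (mod 4)"
  proof -
    obtain c where "p = 2 * c + 1" using p by (rule oddE)
    then have "p * p = 1 + 4 * (c * c + c)" by (simp add: algebra_simps)
    then show ?thesis unfolding cong_def by (simp only: mod_mult_self2)
  qed
  then have "[(p * p) ^ e = 1 ^ e] (mod 4)" by (rule cong_pow)
  then have "[r * p * (p * p) ^ e = 1 * 1] (mod 4)"
    using cong_mult[OF rp] by fastforce
  then have "[r * p ^ (2 * e + 1) = 1] (mod 4)"
    by (simp add: power_mult power2_eq_square mult.assoc)
  then have "(r * p ^ (2 * e + 1)) mod 4 = 1" by (simp add: cong_def)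
  then have "4 * ((r * p ^ (2 * e + 1) - 1) div 4) + 1 = r * p ^ (2 * e + 1)"
    by presburger
  then have "4 * (p ^ (2 * e + 2) * n + (r * p ^ (2 * e + 1) - 1) div 4) + 1 =
    4 * (p ^ (2 * e + 2) * n) + r * p ^ (2 * e + 1)"
    by simp
  also have "\<dots> = p ^ (2 * e + 1) * (4 * p * n + r)"
    by (simp add: algebra_simps)
  finally show ?thesis .
qed

theorem corollary1p7:
  shows "(\<forall>p r :: nat. prime p \<and> [p = 3] (mod 4) \<and> 1 \<le> r \<and> r < 4 * p \<and> gcd r p = 1 \<and>
            [r * p = 1] (mod 4) \<longrightarrow>
            (\<forall>\<alpha> n :: nat.
               [ped_minus2 (p ^ (2 * \<alpha> + 2) * n + (r * p ^ (2 * \<alpha> + 1) - 1) div 4) = 0] (mod 8)))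
       \<and> (\<forall>p r :: nat. prime p \<and> [p = 1] (mod 4) \<and> 1 \<le> r \<and> r < 4 * p \<and> gcd r p = 1 \<and>
            [r * p = 1] (mod 4) \<longrightarrow>
            (\<forall>\<alpha> n :: nat.
               [ped_minus2 (p ^ (8 * \<alpha> + 8) * n + (r * p ^ (8 * \<alpha> + 7) - 1) div 4) = 0] (mod 8)))"
proof (intro conjI allI impI; elim conjE)
  fix p r \<alpha> n :: nat
  assume p: "prime p" and p4: "[p = 3] (mod 4)" and gcd: "gcd r p = 1" and rp: "[r * p = 1] (mod 4)"
  have "odd p" using p4 unfolding cong_def by presburger
  then show "[ped_minus2 (p ^ (2 * \<alpha> + 2) * n + (r * p ^ (2 * \<alpha> + 1) - 1) div 4) = 0] (mod 8)"
    using p4 by (intro ped_minus2_cong_8_of_prime_power[OF p _ coprime_arith_progression[OF p gcd]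
          four_times_index[OF rp]]) simp_all
next
  fix p r \<alpha> n :: nat
  assume p: "prime p" and p4: "[p = 1] (mod 4)" and gcd: "gcd r p = 1" and rp: "[r * p = 1] (mod 4)"
  have "odd p" using p4 unfolding cong_def by presburger
  \<comment> \<open>Here \<open>e = 4 * \<alpha> + 3\<close>, chosen so that 4 divides
    \<open>e + 1\<close>.\<close>
  moreover have e: "8 * \<alpha> + 8 = 2 * (4 * \<alpha> + 3) + 2" "8 * \<alpha> + 7 = 2 * (4 * \<alpha> + 3) + 1"
    by simp_all
  ultimately show "[ped_minus2 (p ^ (8 * \<alpha> + 8) * n + (r * p ^ (8 * \<alpha> + 7) - 1) div 4) = 0] (mod 8)"
    unfolding e by (intro ped_minus2_cong_8_of_prime_power[OF p _ coprime_arith_progression[OF p gcd]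
          four_times_index[OF rp]]) simp_all
qed

end
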